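(* For all $s\in\mathbb{Q}_{>0}$ and all real $\kappa,\lambda$, as meromorphic functions in $(x,z)\in\mathbb{C}\times\mathbb{C}$, $$\frac{c_J(x,-z)}{c_J^d(z,-x)}=\frac{c_R(x,-z)}{c_R^d(\frac{z}{2},-2x)},\qquad \frac{c_J(x,z)-c_J^d(z,x)}{c_J^d(z,-x)}=\frac{c_R(x,z)-c_R^d(\frac{z}{2},2x)}{c_R^d(\frac{z}{2},-2x)}.$$
   Context: Fix $\tau\in\sqrt{-1}\,\mathbb{R}_{>0}$, put $q^x:=e^{2\pi\sqrt{-1}\tau x}$ for $x\in\mathbb{C}$, so $0<q=e^{2\pi\sqrt{-1}\tau}<1$. Theta functions: $(u;p)_\infty=\prod_{i\geq 0}(1-up^i)$, $\theta(u;p)=(u;p)_\infty(p/u;p)_\infty$, $\theta(u_1,\ldots,u_r;p)=\prod_{i=1}^r\theta(u_i;p)$. For a step-size $s\in\mathbb{Q}_{>0}$ and real $\kappa,\lambda,\upsilon,\varsigma$, put $d_s=-q^{\frac{s}{2}+\upsilon-\varsigma}$, $\widetilde a_s=q^{\kappa+\upsilon}$, $\widetilde b_s=-q^{\kappa-\upsilon}$, $\widetilde c_s=q^{\frac{s}{2}+\lambda+\varsigma}$, $W(x,z)=q^{(\kappa+\lambda+x)(\kappa+\upsilon+z)/s}$, and define the normalized $c$-function $$c(x,z;\kappa,\lambda,\upsilon,\varsigma;q,s)=\frac{\theta\bigl(\widetilde a_sq^{-z},\widetilde b_sq^{-z},\widetilde c_sq^{-z},\frac{d_sq^{x-z}}{\widetilde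 a_s};q^s\bigr)}{W(x,z)\,\theta\bigl(q^{-2z},d_sq^x;q^s\bigr)}.$$ For fixed $\kappa,\lambda,s$ set $c_J(x,z):=c(x,z;\kappa,\lambda,\kappa,\lambda;q,s)$, $\ c_J^d(x,z):=c(x,z;\kappa,\kappa,\lambda,\lambda;q,s)$, $c_R(x,z):=c\bigl(x,\tfrac z2;\kappa,\lambda,0,0;q,\tfrac s2\bigr)$, $\ c_R^d(x,z):=c\bigl(x,\tfrac z2;\kappa,0,\lambda,0;q,\tfrac s2\bigr)$. *)

theory Defs
  imports "HOL-Analysis.Analysis"
begin

subsection \<open>Meromorphic functions of two complex variables\<close>

text \<open>Complex differentiability at every point of an open subset of \<open>\<complex> \<times> \<complex>\<close>: the real derivative
  exists and is \<open>\<complex>\<close>-linear.\<close>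

definition holomorphic2_on :: "(complex \<times> complex \<Rightarrow> complex) \<Rightarrow> (complex \<times> complex) set \<Rightarrow> bool" where
  "holomorphic2_on F U \<longleftrightarrow> open U \<and>
     (\<forall>w\<in>U. \<exists>a b. (F has_derivative (\<lambda>v. a * fst v + b * snd v)) (at w))"

text \<open>A total function represents a meromorphic function on \<open>\<complex> \<times> \<complex>\<close> if it is locally a quotient
  \<open>N / D\<close> of holomorphic functions, where \<open>D\<close> vanishes identically on no nonempty open set. The
  values at the zeros of \<open>D\<close> (poles and points of indeterminacy) are irrelevant.\<close>

definition meromorphic2 :: "(complex \<times> complex \<Rightarrow> complex) \<Rightarrow> bool" where
  "meromorphic2 F \<longleftrightarrow>
     (\<forall>w. \<exists>U N D. w \<in> U \<and> holomorphic2_on N U \<and> holomorphic2_on D U \<and>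
        U \<subseteq> closure {v \<in> U. D v \<noteq> 0} \<and>
        (\<forall>v\<in>U. D v \<noteq> 0 \<longrightarrow> F v = N v / D v))"

text \<open>Equality as meromorphic functions on \<open>\<complex> \<times> \<complex>\<close>: two representatives define the same
  meromorphic function iff they agree on a dense open set.\<close>

definition meromorphic2_eq ::
  "(complex \<times> complex \<Rightarrow> complex) \<Rightarrow> (complex \<times> complex \<Rightarrow> complex) \<Rightarrow> bool" where
  "meromorphic2_eq F G \<longleftrightarrow> meromorphic2 F \<and> meromorphic2 G \<and>
     (\<exists>V. open V \<and> closure V = UNIV \<and> (\<forall>w\<in>V. F w = G w))"

subsection \<open>Theta functions\<close>

definition qpochhammer_inf :: "complex \<Rightarrow> complex \<Rightarrow> complex" where
  "qpochhammer_inf u p = prodinf (\<lambda>i. 1 - u * p ^ i)"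

definition theta :: "complex \<Rightarrow> complex \<Rightarrow> complex" where
  "theta u p = qpochhammer_inf u p * qpochhammer_inf (p / u) p"

definition thetas :: "complex list \<Rightarrow> complex \<Rightarrow> complex" where
  "thetas us p = (\<Prod>u\<leftarrow>us. theta u p)"

subsection \<open>The normalized \<open>c\<close>-function\<close>

text \<open>\<open>qpow \<tau> x\<close> is \<open>q\<^sup>x\<close> for \<open>q = e\<^bsup>2\<pi>i\<tau>\<^esup>\<close>. The branch of the power is determined by \<open>\<tau>\<close>, so the
  functions below carry \<open>\<tau>\<close> as a parameter in place of \<open>q\<close>.\<close>

definition qpow :: "complex \<Rightarrow> complex \<Rightarrow> complex" where
  "qpow \<tau> x = exp (2 * of_real pi * \<i> * \<tau> * x)"

text \<open>\<open>lam\<close> is the parameter \<open>\<lambda>\<close>, \<open>\<sigma>\<close> is varsigma, and \<open>a\<close>, \<open>b\<close>, \<open>c\<close> are the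
  parameters with tildes. The argument order is \<open>\<tau>\<close>, \<open>s\<close>, \<open>\<kappa>\<close>, \<open>lam\<close>, \<open>\<upsilon>\<close>, \<open>\<sigma>\<close>, \<open>x\<close>, \<open>z\<close>.\<close>

definition cfun ::
  "complex \<Rightarrow> real \<Rightarrow> real \<Rightarrow> real \<Rightarrow> real \<Rightarrow> real \<Rightarrow> complex \<Rightarrow> complex \<Rightarrow> complex" where
  "cfun \<tau> s \<kappa> lam \<upsilon> \<sigma> x z =
     (let q = qpow \<tau>;
          p = q (of_real s);
          d = - q (of_real (s / 2 + \<upsilon> - \<sigma>));
          a = q (of_real (\<kappa> + \<upsilon>));
          b = - q (of_real (\<kappa> - \<upsilon>));
          c = q (of_real (s / 2 + lam + \<sigma>));
          W = q ((of_real (\<kappa> + lam) + x) * (of_real (\<kappa> + \<upsilon>) + z) / of_real s)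
      in thetas [a * q (- z), b * q (- z), c * q (- z), d * q (x - z) / a] p
         / (W * thetas [q (- 2 * z), d * q x] p))"

definition cJ :: "complex \<Rightarrow> real \<Rightarrow> real \<Rightarrow> real \<Rightarrow> complex \<Rightarrow> complex \<Rightarrow> complex" where
  "cJ \<tau> s \<kappa> lam x z = cfun \<tau> s \<kappa> lam \<kappa> lam x z"

definition cJd :: "complex \<Rightarrow> real \<Rightarrow> real \<Rightarrow> real \<Rightarrow> complex \<Rightarrow> complex \<Rightarrow> complex" where
  "cJd \<tau> s \<kappa> lam x z = cfun \<tau> s \<kappa> \<kappa> lam lam x z"

definition cR :: "complex \<Rightarrow> real \<Rightarrow> real \<Rightarrow> real \<Rightarrow> complex \<Rightarrow> complex \<Rightarrow> complex" where
  "cR \<tau> s \<kappa> lam x z = cfun \<tau> (s / 2) \<kappa> lam 0 0 x (z / 2)"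

definition cRd :: "complex \<Rightarrow> real \<Rightarrow> real \<Rightarrow> real \<Rightarrow> complex \<Rightarrow> complex \<Rightarrow> complex" where
  "cRd \<tau> s \<kappa> lam x z = cfun \<tau> (s / 2) \<kappa> 0 lam 0 x (z / 2)"

end

theory Submission
  imports Defs "HOL-Complex_Analysis.Complex_Analysis"
begin

text \<open>
  Write \<open>X = q\<^sup>x\<close>, \<open>\<zeta> = q\<^bsup>z/2\<^esup>\<close>, \<open>K = q\<^sup>\<kappa>\<close>, \<open>L = q\<^sup>\<lambda>\<close> and \<open>r = q\<^bsup>s/4\<^esup>\<close>. The functions \<open>cJ\<close>, \<open>cJd\<close> are
  quotients of theta functions of nome \<open>r\<^sup>4\<close> and \<open>cR\<close>, \<open>cRd\<close> of nome \<open>r\<^sup>2\<close>. The exponential factors \<open>W\<close>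
  of all four functions agree once the arguments are matched as in the theorem
  (\<open>c_functions_as_theta_quotients\<close>), so they contribute the same factor to both sides of each
  equation and drop out. What remains are identities between theta functions of the two nomes.

  The first one is a rearrangement of the doubling formulas \<open>\<theta>(u;r\<^sup>2) = \<theta>(u;r\<^sup>4) \<theta>(r\<^sup>2u;r\<^sup>4)\<close> and
  \<open>\<theta>(u\<^sup>2;r\<^sup>4) = \<theta>(u;r\<^sup>2) \<theta>(-u;r\<^sup>2)\<close> (\<open>ratio_identity\<close>).

  For the second one, write \<open>cJd'\<close> and \<open>cRd'\<close> for the dual functions at the reflected argument, which
  are the denominators in the theorem, and regroup the identity as
  \<open>cJ/cJd' - cR/cRd' = cJd/cJd' - cRd/cRd'\<close>. Over a common denominator each side has as numerator the
  difference of two products of theta functions of mixed nomes. Each of these differences is a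
  single product, by \<open>theta_three_term_double_nome\<close> and \<open>theta_three_term_half_nome\<close>, and the two
  products so obtained agree (\<open>difference_identity\<close>). The doubling formulas bring either lemma to a
  single nome, where it is an instance of the three-term identity of Weierstrass
  (\<open>theta_weierstrass\<close>).

  The three-term identity is proved by Liouville's theorem. As functions of \<open>x = e\<^sup>w\<close>, its three
  terms have the same quasi-periodicity as \<open>\<theta>(xv) \<theta>(x/v)\<close>, whose zeros are simple for generic \<open>v\<close>.
  The difference of the two sides vanishes at these zeros, so its quotient by this product is entire
  and doubly periodic, hence constant, and it vanishes at \<open>x = y\<close>.

  These identities hold wherever finitely many theta functions of exponentials of nonconstant
  linear forms in \<open>x\<close> and \<open>z\<close> do not vanish. Restricted to a suitable complex line through a given
  point, each such function has only countably many zeros, so the set of good points is open and dense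
  (\<open>generic_theta_qpow\<close>). The same fact shows that all functions involved are quotients of entire
  functions of two variables with generically nonzero denominators.
\<close>

section \<open>Theta functions\<close>

lemma summable_norm_qpochhammer:
  fixes u p :: complex
  assumes "norm p < 1"
  shows "summable (\<lambda>i. norm ((1 - u * p ^ i) - 1))"
  using assms by (simp add: norm_mult norm_power summable_geometric summable_mult)

lemma convergent_prod_qpochhammer:
  fixes u p :: complex
  assumes "norm p < 1"
  shows "convergent_prod (\<lambda>i. 1 - u * p ^ i)"
  using summable_imp_abs_convergent_prod[OF summable_norm_qpochhammer[OF assms]]
  by (rule abs_convergent_prod_imp_convergent_prod)

lemma qpochhammer_inf_LIMSEQ:
  assumes "norm p < 1"
  shows "(\<lambda>n. \<Prod>i<n. 1 - u * p ^ i) \<longlonglongrightarrow> qpochhammer_inf u p"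
  using convergent_prod_LIMSEQ[OF convergent_prod_qpochhammer[OF assms]]
  by (simp add: qpochhammer_inf_def LIMSEQ_lessThan_iff_atMost)

lemma qpochhammer_inf_eq_0_iff:
  assumes "norm p < 1"
  shows "qpochhammer_inf u p = 0 \<longleftrightarrow> (\<exists>i. u * p ^ i = 1)"
proof -
  have "(\<lambda>i. 1 - u * p ^ i) has_prod qpochhammer_inf u p"
    using convergent_prod_qpochhammer[OF assms] by (simp add: qpochhammer_inf_def convergent_prod_has_prod)
  from has_prod_eq_0_iff[OF this] show ?thesis
    by (auto simp: image_iff)
qed

lemma qpochhammer_inf_holomorphic:
  assumes "norm p < 1"
  shows "(\<lambda>u. qpochhammer_inf u p) holomorphic_on UNIV"
proof (rule holomorphic_uniform_sequence)
  show "(\<lambda>u. \<Prod>i<n. 1 - u * p ^ i) holomorphic_on UNIV" for n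
    by (intro holomorphic_intros)
  fix u :: complex
  define R where "R = norm u + 1"
  have "uniformly_convergent_on (cball u 1) (\<lambda>n v. \<Sum>i<n. norm ((1 - v * p ^ i) - 1))"
  proof (rule Weierstrass_m_test')
    show "summable (\<lambda>i. R * norm p ^ i)"
      using assms by (intro summable_mult summable_geometric) auto
    fix i and v assume "v \<in> cball u 1"
    then have "norm v \<le> R"
      using norm_triangle_ineq2[of v u] by (simp add: R_def dist_norm norm_minus_commute)
    then show "norm (norm ((1 - v * p ^ i) - 1)) \<le> R * norm p ^ i"
      by (simp add: norm_mult norm_power mult_right_mono)
  qed
  then have "uniformly_convergent_on (cball u 1) (\<lambda>n v. \<Prod>i<n. 1 - v * p ^ i)"
    by (intro uniformly_convergent_on_prod' continuous_intros) auto
  then obtain l where l: "uniform_limit (cball u 1) (\<lambda>n v. \<Prod>i<n. 1 - v * p ^ i) l sequentially"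
    by (auto simp: uniformly_convergent_on_def)
  have "l v = qpochhammer_inf v p" if "v \<in> cball u 1" for v
    using LIMSEQ_unique[OF tendsto_uniform_limitI[OF l that] qpochhammer_inf_LIMSEQ[OF assms]] .
  then have "uniform_limit (cball u 1) (\<lambda>n v. \<Prod>i<n. 1 - v * p ^ i)
      (\<lambda>v. qpochhammer_inf v p) sequentially"
    by (intro iffD1[OF uniform_limit_cong' l]) auto
  then show "\<exists>d>0. cball u d \<subseteq> UNIV \<and> uniform_limit (cball u d) (\<lambda>n v. \<Prod>i<n. 1 - v * p ^ i)
      (\<lambda>v. qpochhammer_inf v p) sequentially"
    by (intro exI[of _ 1]) auto
qed auto

lemma holomorphic_on_qpochhammer_inf [holomorphic_intros]:
  assumes "norm p < 1" "f holomorphic_on A"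
  shows "(\<lambda>x. qpochhammer_inf (f x) p) holomorphic_on A"
  using holomorphic_on_compose_gen[OF assms(2) qpochhammer_inf_holomorphic[OF assms(1)]]
  by (auto simp: o_def)

lemma theta_holomorphic:
  assumes "norm p < 1" "f holomorphic_on A" "\<And>x. x \<in> A \<Longrightarrow> f x \<noteq> 0"
  shows "(\<lambda>x. theta (f x) p) holomorphic_on A"
  unfolding theta_def using assms by (intro holomorphic_intros) auto

lemma qpochhammer_inf_mult_p:
  assumes "norm p < 1"
  shows "qpochhammer_inf u p = (1 - u) * qpochhammer_inf (u * p) p"
proof -
  have "(\<lambda>n. (1 - u) * (\<Prod>i<n. 1 - u * p * p ^ i)) \<longlonglongrightarrow> (1 - u) * qpochhammer_inf (u * p) p"
    by (intro tendsto_intros qpochhammer_inf_LIMSEQ assms)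
  moreover have "(1 - u) * (\<Prod>i<n. 1 - u * p * p ^ i) = (\<Prod>i<Suc n. 1 - u * p ^ i)" for n
    by (subst prod.lessThan_Suc_shift) (simp add: mult_ac)
  ultimately show ?thesis
    using LIMSEQ_unique[OF LIMSEQ_Suc[OF qpochhammer_inf_LIMSEQ[OF assms, of u]]] by simp
qed

lemma qpochhammer_inf_square:
  assumes "norm p < 1"
  shows "qpochhammer_inf (u\<^sup>2) (p\<^sup>2) = qpochhammer_inf u p * qpochhammer_inf (- u) p"
proof -
  have "(1 - u * p ^ i) * (1 - (- u) * p ^ i) = 1 - u\<^sup>2 * (p\<^sup>2) ^ i" for i
    by (simp add: algebra_simps power2_eq_square power_mult_distrib)
  then show ?thesis
    using prodinf_mult[OF convergent_prod_qpochhammer[OF assms, of u] convergent_prod_qpochhammer[OF assms, of "-u"]]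
    by (simp add: qpochhammer_inf_def)
qed

text \<open>The partial products of even length split into the factors with even and with odd index.\<close>

lemma qpochhammer_inf_even_odd:
  assumes "norm p < 1"
  shows "qpochhammer_inf u p = qpochhammer_inf u (p\<^sup>2) * qpochhammer_inf (u * p) (p\<^sup>2)"
proof -
  have p2: "norm (p\<^sup>2) < 1"
    using assms by (simp add: norm_power power_less_one_iff)
  have split: "(\<Prod>i<2 * n. 1 - u * p ^ i) = (\<Prod>i<n. 1 - u * (p\<^sup>2) ^ i) * (\<Prod>i<n. 1 - u * p * (p\<^sup>2) ^ i)" for n
    by (induction n) (simp_all add: power_mult [symmetric] mult_ac)
  have "(\<lambda>n. \<Prod>i<2 * n. 1 - u * p ^ i) \<longlonglongrightarrow> qpochhammer_inf u p"
    using LIMSEQ_subseq_LIMSEQ[OF qpochhammer_inf_LIMSEQ[OF assms], of "\<lambda>n. 2 * n"]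
    by (simp add: strict_mono_def o_def)
  moreover have "(\<lambda>n. \<Prod>i<2 * n. 1 - u * p ^ i)
      \<longlonglongrightarrow> qpochhammer_inf u (p\<^sup>2) * qpochhammer_inf (u * p) (p\<^sup>2)"
    unfolding split by (intro tendsto_mult qpochhammer_inf_LIMSEQ p2)
  ultimately show ?thesis
    by (rule LIMSEQ_unique)
qed

lemma theta_reflect:
  assumes "p \<noteq> 0"
  shows "theta (p / u) p = theta u p"
  using assms by (cases "u = 0") (simp_all add: theta_def)

lemma theta_inverse:
  assumes "norm p < 1" "u \<noteq> 0"
  shows "theta (1 / u) p = - theta u p / u"
  using assms
  by (simp add: theta_def qpochhammer_inf_mult_p[OF assms(1), of u] qpochhammer_inf_mult_p[OF assms(1), of "1 / u"])
     (simp add: field_simps)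

lemma theta_mult_p:
  assumes "norm p < 1" "u \<noteq> 0" "p \<noteq> 0"
  shows "theta (p * u) p = - theta u p / u"
  using theta_reflect[of p "1 / u"] theta_inverse[OF assms(1,2)] assms by simp

lemma theta_square:
  assumes "norm p < 1"
  shows "theta (u\<^sup>2) (p\<^sup>2) = theta u p * theta (- u) p"
  using qpochhammer_inf_square[OF assms, of u] qpochhammer_inf_square[OF assms, of "p / u"]
  by (simp add: theta_def power_divide)

lemma theta_even_odd:
  assumes "norm p < 1" "p \<noteq> 0"
  shows "theta u p = theta u (p\<^sup>2) * theta (p * u) (p\<^sup>2)"
  using qpochhammer_inf_even_odd[OF assms(1), of u] qpochhammer_inf_even_odd[OF assms(1), of "p / u"] assms
  by (simp add: theta_def power2_eq_square mult_ac)

lemma theta_eq_0_iff: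
  assumes "norm p < 1" "p \<noteq> 0" "u \<noteq> 0"
  shows "theta u p = 0 \<longleftrightarrow> (\<exists>n. u = p powi n)"
proof
  assume "theta u p = 0"
  then consider i where "u * p ^ i = 1" | i where "p / u * p ^ i = 1"
    using qpochhammer_inf_eq_0_iff[OF assms(1)] by (auto simp: theta_def)
  then show "\<exists>n. u = p powi n"
  proof cases
    case 1
    then have "u = p powi (- int i)"
      using assms by (simp add: power_int_minus field_simps)
    then show ?thesis ..
  next
    case 2
    then have "u = p powi (int (Suc i))"
      using assms by (simp add: field_simps del: of_nat_Suc)
    then show ?thesis ..
  qed
next
  assume "\<exists>n. u = p powi n"
  then obtain n where n: "u = p powi n" ..
  show "theta u p = 0"
  proof (cases "n \<le> 0")
    case True
    then have "u * p ^ nat (- n) = 1"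
      using n assms by (simp add: power_int_def field_simps)
    then show ?thesis
      using qpochhammer_inf_eq_0_iff[OF assms(1), of u] by (auto simp: theta_def)
  next
    case False
    then have "u = p * p ^ nat (n - 1)"
      using n assms by (simp add: power_int_def flip: power_Suc) (simp add: Suc_nat_eq_nat_zadd1)
    then have "p / u * p ^ nat (n - 1) = 1"
      using assms by (simp add: field_simps)
    then show ?thesis
      using qpochhammer_inf_eq_0_iff[OF assms(1), of "p / u"] by (auto simp: theta_def)
  qed
qed

lemma thetas_Cons: "thetas (u # us) p = theta u p * thetas us p"
  and thetas_Nil: "thetas [] p = 1"
  by (simp_all add: thetas_def)

section \<open>Sets of countable complement\<close>

lemma closure_Compl_countable:
  fixes S :: "complex set"
  assumes "countable S"
  shows "closure (- S) = UNIV"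
proof -
  have "interior S = {}"
  proof (rule ccontr)
    assume "interior S \<noteq> {}"
    then obtain a e where "e > 0" "ball a e \<subseteq> S"
      by (meson all_not_in_conv mem_interior)
    then show False
      using assms countable_subset uncountable_ball by blast
  qed
  then show ?thesis
    by (simp add: closure_complement)
qed

lemma continuous_eq_off_countable:
  fixes f g :: "complex \<Rightarrow> complex"
  assumes "continuous_on UNIV f" "continuous_on UNIV g" "countable S"
    and "\<And>w. w \<notin> S \<Longrightarrow> f w = g w"
  shows "f w = g w"
proof -
  have "closure (- S) \<subseteq> {w. f w = g w}"
    using assms by (intro closure_minimal closed_Collect_eq) auto
  then show ?thesis
    using closure_Compl_countable[OF assms(3)] by auto
qed

lemma countable_exp_fibre:
  fixes k b :: complex
  assumes "k \<noteq> 0"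
  shows "countable {w. exp (k * w) = b}"
proof (rule countable_subset)
  show "{w. exp (k * w) = b} \<subseteq> range (\<lambda>m::int. (Ln b + of_int (2 * m) * pi * \<i>) / k)"
  proof
    fix w assume "w \<in> {w. exp (k * w) = b}"
    then have "exp (k * w) = exp (Ln b)"
      by auto
    then obtain m :: int where "k * w = Ln b + of_int (2 * m) * pi * \<i>"
      by (auto simp: exp_eq)
    then have "w = (Ln b + of_int (2 * m) * pi * \<i>) / k"
      using assms by (simp add: field_simps)
    then show "w \<in> range (\<lambda>m::int. (Ln b + of_int (2 * m) * pi * \<i>) / k)"
      by blast
  qed
qed auto

text \<open>By the exponential map the zeros \<open>p\<^sup>n\<close> of the theta function pull back to countably many points. All
  density arguments below rest on this.\<close>

lemma countable_theta_exp_zeros: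
  fixes a k p :: complex
  assumes "norm p < 1" "p \<noteq> 0" "a \<noteq> 0" "k \<noteq> 0"
  shows "countable {w. theta (a * exp (k * w)) p = 0}"
proof (rule countable_subset)
  show "{w. theta (a * exp (k * w)) p = 0} \<subseteq> (\<Union>n. {w. exp (k * w) = p powi n / a})"
    using assms theta_eq_0_iff by (auto simp: field_simps)
qed (use countable_exp_fibre[OF assms(4)] in auto)

section \<open>Entire functions\<close>

text \<open>At a zero \<open>w\<^sub>0\<close> of \<open>g\<close> the factor \<open>w - w\<^sub>0\<close> splits off from both functions, and the cofactor of \<open>g\<close>
  has the nonzero value \<open>g'(w\<^sub>0)\<close> there.\<close>

lemma entire_quotient_of_simple_zeros:
  assumes f: "f holomorphic_on UNIV" and g: "g holomorphic_on UNIV"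
    and zero: "\<And>w. g w = 0 \<Longrightarrow> f w = 0" and simple: "\<And>w. g w = 0 \<Longrightarrow> deriv g w \<noteq> 0"
  obtains h where "h holomorphic_on UNIV" "\<And>w. f w = g w * h w"
proof -
  \<comment> \<open>The value at a zero is the limit given by the rule of de l'Hospital.\<close>
  define h where "h w = (if g w = 0 then deriv f w / deriv g w else f w / g w)" for w
  have local: "\<exists>U. open U \<and> w0 \<in> U \<and> h holomorphic_on U" for w0
  proof (cases "g w0 = 0")
    case False
    have "open {w. g w \<noteq> 0}"
      using g by (intro open_Collect_neq holomorphic_on_imp_continuous_on continuous_intros)
    moreover have "h holomorphic_on {w. g w \<noteq> 0}"
    proof (rule holomorphic_transform)
      show "(\<lambda>w. f w / g w) holomorphic_on {w. g w \<noteq> 0}"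
        by (intro holomorphic_intros holomorphic_on_subset[OF f] holomorphic_on_subset[OF g]) auto
    qed (auto simp: h_def)
    ultimately show ?thesis
      using False by blast
  next
    case True
    define F where "F w = (if w = w0 then deriv f w0 else (f w - f w0) / (w - w0))" for w
    define G where "G w = (if w = w0 then deriv g w0 else (g w - g w0) / (w - w0))" for w
    have F: "F holomorphic_on UNIV" and G: "G holomorphic_on UNIV"
      using pole_lemma_open[OF f open_UNIV, of w0] pole_lemma_open[OF g open_UNIV, of w0]
      by (simp_all add: F_def [abs_def] G_def [abs_def])
    have "open {w. G w \<noteq> 0}"
      using G by (intro open_Collect_neq holomorphic_on_imp_continuous_on continuous_intros)
    moreover have "h holomorphic_on {w. G w \<noteq> 0}"
    proof (rule holomorphic_transform)
      show "(\<lambda>w. F w / G w) holomorphic_on {w. G w \<noteq> 0}"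
        by (intro holomorphic_intros holomorphic_on_subset[OF F] holomorphic_on_subset[OF G]) auto
    qed (use True zero[OF True] in \<open>auto simp: h_def F_def G_def split: if_splits\<close>)
    ultimately show ?thesis
      using simple[OF True] by (intro exI[of _ "{w. G w \<noteq> 0}"]) (auto simp: G_def)
  qed
  have "h holomorphic_on UNIV"
    unfolding holomorphic_on_def
  proof
    fix w0
    obtain U where "open U" "w0 \<in> U" "h holomorphic_on U"
      using local by blast
    then show "h field_differentiable at w0 within UNIV"
      by (metis holomorphic_on_imp_differentiable_at)
  qed
  moreover have "f w = g w * h w" for w
    using zero[of w] by (simp add: h_def)
  ultimately show ?thesis
    using that by blast
qed

text \<open>The values are those on one compact period rectangle, so that the theorem of Liouville applies.\<close>

lemma entire_doubly_periodic_constant: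
  assumes h: "h holomorphic_on UNIV" and c: "Re c < 0"
    and per1: "\<And>w. h (w + 2 * of_real pi * \<i>) = h w" and per2: "\<And>w. h (w + c) = h w"
  shows "h constant_on UNIV"
proof (rule Liouville_theorem[OF h])
  have nat1: "h (w + of_nat n * (2 * of_real pi * \<i>)) = h w" for w n
  proof (induction n)
    case (Suc n)
    then show ?case
      using per1[of "w + of_nat n * (2 * of_real pi * \<i>)"] by (simp add: algebra_simps)
  qed simp
  have nat2: "h (w + of_nat n * c) = h w" for w n
  proof (induction n)
    case (Suc n)
    then show ?case
      using per2[of "w + of_nat n * c"] by (simp add: algebra_simps)
  qed simp
  have int1: "h (w + of_int n * (2 * of_real pi * \<i>)) = h w" for w n
    using nat1[of w "nat n"] nat1[of "w + of_int n * (2 * of_real pi * \<i>)" "nat (- n)"]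
    by (cases "n \<ge> 0") simp_all
  have int2: "h (w + of_int n * c) = h w" for w n
    using nat2[of w "nat n"] nat2[of "w + of_int n * c" "nat (- n)"]
    by (cases "n \<ge> 0") simp_all
  let ?B = "cbox (Complex (Re c) 0) (Complex 0 (2 * pi))"
  have "range h \<subseteq> h ` ?B"
  proof safe
    fix w
    define m where "m = \<lfloor>- (Re w / Re c)\<rfloor> + 1"
    define w1 where "w1 = w + of_int m * c"
    have "of_int m - 1 \<le> - (Re w / Re c)" "- (Re w / Re c) \<le> of_int m"
      unfolding m_def by linarith+
    then have "Re w + of_int m * Re c \<le> 0" "Re c \<le> Re w + of_int m * Re c"
      using c by (simp_all add: field_simps)
    then have re: "Re w1 \<le> 0" "Re c \<le> Re w1"
      by (simp_all add: w1_def)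
    define n where "n = \<lfloor>- (Im w1 / (2 * pi))\<rfloor> + 1"
    define w2 where "w2 = w1 + of_int n * (2 * of_real pi * \<i>)"
    have "of_int n - 1 \<le> - (Im w1 / (2 * pi))" "- (Im w1 / (2 * pi)) \<le> of_int n"
      unfolding n_def by linarith+
    then have "0 \<le> Im w1 + of_int n * (2 * pi)" "Im w1 + of_int n * (2 * pi) \<le> 2 * pi"
      by (simp_all add: field_simps)
    then have "w2 \<in> ?B"
      using re by (simp add: w2_def in_cbox_complex_iff)
    moreover have "h w = h w2"
      using int1[of w1 n] int2[of w m] by (simp add: w1_def w2_def)
    ultimately show "h w \<in> h ` ?B"
      by blast
  qed
  moreover have "compact (h ` ?B)"
    by (intro compact_continuous_image compact_cbox holomorphic_on_imp_continuous_on
        holomorphic_on_subset[OF h]) auto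
  ultimately show "bounded (range h)"
    using bounded_subset compact_imp_bounded by blast
qed

section \<open>The three-term identity of Weierstrass\<close>

text \<open>The product that occurs in the three-term identity. In additive notation it is the sigma-function
  product \<open>\<sigma>(a + b) \<sigma>(a - b)\<close> up to elementary factors: it is antisymmetric up to the factor \<open>x / y\<close>, and
  its multiplier under \<open>x \<mapsto> p x\<close> does not depend on \<open>y\<close>.\<close>

definition theta_pair :: "complex \<Rightarrow> complex \<Rightarrow> complex \<Rightarrow> complex" where
  "theta_pair p x y = theta (x * y) p * theta (x / y) p"

lemma theta_pair_mult_p:
  assumes "norm p < 1" "p \<noteq> 0" "x \<noteq> 0" "y \<noteq> 0"
  shows "theta_pair p (p * x) y = inverse (x\<^sup>2) * theta_pair p x y"
  using theta_mult_p[of p "x * y"] theta_mult_p[of p "x / y"] assms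
  by (simp add: theta_pair_def mult.assoc power2_eq_square divide_inverse)

lemma theta_pair_inverse:
  assumes "norm p < 1" "x \<noteq> 0" "y \<noteq> 0"
  shows "theta_pair p (1 / x) y = inverse (x\<^sup>2) * theta_pair p x y"
  using theta_inverse[of p "x * y"] theta_inverse[of p "x / y"] assms
  by (simp add: theta_pair_def power2_eq_square divide_inverse)

lemma theta_pair_commute:
  assumes "norm p < 1" "x \<noteq> 0" "y \<noteq> 0"
  shows "theta_pair p x y = - (x / y) * theta_pair p y x"
  using theta_inverse[OF assms(1), of "y / x"] assms
  by (simp add: theta_pair_def mult.commute)

lemma theta_1: "norm p < 1 \<Longrightarrow> theta 1 p = 0"
  using qpochhammer_inf_mult_p[of p 1] by (simp add: theta_def)

lemma quasiperiodic_zero_powi: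
  fixes F :: "complex \<Rightarrow> complex"
  assumes p: "p \<noteq> 0" and quasi: "\<And>x. x \<noteq> 0 \<Longrightarrow> F (p * x) = m x * F x"
    and m: "\<And>x. x \<noteq> 0 \<Longrightarrow> m x \<noteq> 0" and x: "x \<noteq> 0" and zero: "F x = 0"
  shows "F (p powi n * x) = 0"
proof (induction n rule: int_induct[where k = 0])
  case (step1 i)
  then show ?case
    using quasi[of "p powi i * x"] p x by (simp add: power_int_add_1 mult_ac)
next
  case (step2 i)
  have "p * (p powi (i - 1) * x) = p powi i * x"
    using p by (simp add: power_int_diff)
  then have "F (p powi i * x) = m (p powi (i - 1) * x) * F (p powi (i - 1) * x)"
    using quasi[of "p powi (i - 1) * x"] p x by (simp only:) simp
  then show ?case
    using m[of "p powi (i - 1) * x"] p x step2 by simp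
qed (use zero in simp)

text \<open>The zero at \<open>1\<close> comes from the factor \<open>1 - u\<close> alone, and \<open>\<theta>(pu) = - \<theta>(u) / u\<close> carries this to all other
  zeros \<open>p\<^sup>n\<close>.\<close>

lemma deriv_theta_nonzero:
  assumes p: "norm p < 1" "p \<noteq> 0" and u: "u \<noteq> 0" "theta u p = 0"
  shows "deriv (\<lambda>u. theta u p) u \<noteq> 0"
proof -
  have hol: "(\<lambda>u. theta u p) holomorphic_on - {0}"
    using p by (intro theta_holomorphic holomorphic_intros) auto
  have D: "((\<lambda>u. theta u p) has_field_derivative deriv (\<lambda>u. theta u p) u) (at u)" if "u \<noteq> 0" for u
    using holomorphic_derivI[OF hol, of u] that by auto
  have base: "deriv (\<lambda>u. theta u p) 1 = - (qpochhammer_inf p p * qpochhammer_inf p p)"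
  proof (rule DERIV_imp_deriv)
    define R where "R u = qpochhammer_inf (u * p) p * qpochhammer_inf (p / u) p" for u
    have "R holomorphic_on - {0}"
      unfolding R_def using p by (intro holomorphic_intros) auto
    then have "(R has_field_derivative deriv R 1) (at 1)"
      using holomorphic_derivI[of R "- {0}" 1] by auto
    then have "((\<lambda>u. (1 - u) * R u) has_field_derivative - R 1) (at 1)"
      by (auto intro!: derivative_eq_intros)
    moreover have "theta u p = (1 - u) * R u" for u
      using qpochhammer_inf_mult_p[OF p(1), of u] by (simp add: theta_def R_def)
    ultimately show "((\<lambda>u. theta u p) has_field_derivative - (qpochhammer_inf p p * qpochhammer_inf p p)) (at 1)"
      by (simp add: R_def)
  qed
  have "p * p ^ i \<noteq> 1" for i
  proof -
    have "norm (p ^ Suc i) < 1"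
      using p unfolding norm_power by (intro power_Suc_less_one) auto
    then show ?thesis
      by auto
  qed
  then have base': "deriv (\<lambda>u. theta u p) 1 \<noteq> 0"
    using base qpochhammer_inf_eq_0_iff[OF p(1), of p] by simp
  have step: "p * deriv (\<lambda>u. theta u p) (p * u) = - deriv (\<lambda>u. theta u p) u / u"
    if "u \<noteq> 0" "theta u p = 0" for u
  proof -
    have "((\<lambda>u. theta (p * u) p) has_field_derivative deriv (\<lambda>u. theta u p) (p * u) * p) (at u)"
      by (rule DERIV_chain2[OF D]) (use that p in \<open>auto intro!: derivative_eq_intros\<close>)
    moreover have "((\<lambda>u. - theta u p / u) has_field_derivative - deriv (\<lambda>u. theta u p) u / u) (at u)"
      using that by (auto intro!: derivative_eq_intros D)
    then have "((\<lambda>u. theta (p * u) p) has_field_derivative - deriv (\<lambda>u. theta u p) u / u) (at u)"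
      by (rule has_field_derivative_transform_within_open[where S = "- {0}"])
         (use that p theta_mult_p in auto)
    ultimately show ?thesis
      using DERIV_unique by fastforce
  qed
  have zero: "theta (p powi n) p = 0" for n
    using theta_eq_0_iff[OF p, of "p powi n"] p by auto
  have "deriv (\<lambda>u. theta u p) (p powi n) \<noteq> 0" for n
  proof (induction n rule: int_induct[where k = 0])
    case (step1 i)
    then show ?case
      using step[of "p powi i"] zero[of i] p by (auto simp: power_int_add_1 mult_ac)
  next
    case (step2 i)
    have "p * p powi (i - 1) = p powi i"
      using p by (simp add: power_int_diff)
    then show ?case
      using step[of "p powi (i - 1)"] zero[of "i - 1"] p step2 by auto
  qed (use base' in simp)
  then show ?thesis
    using theta_eq_0_iff[OF p u(1)] u(2) by auto
qed

lemma theta_exp_holomorphic: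
  assumes "norm p < 1" "a \<noteq> 0"
  shows "(\<lambda>w. theta (a * exp w) p) holomorphic_on UNIV"
  using assms by (intro theta_holomorphic holomorphic_intros) auto

lemma deriv_theta_exp_nonzero:
  assumes p: "norm p < 1" "p \<noteq> 0" and a: "a \<noteq> 0" and zero: "theta (a * exp w) p = 0"
  shows "deriv (\<lambda>w. theta (a * exp w) p) w \<noteq> 0"
proof -
  have hol: "(\<lambda>u. theta u p) holomorphic_on - {0}"
    using p by (intro theta_holomorphic holomorphic_intros) auto
  have "((\<lambda>u. theta u p) has_field_derivative deriv (\<lambda>u. theta u p) (a * exp w)) (at (a * exp w))"
    using holomorphic_derivI[OF hol, of "a * exp w"] a by auto
  then have "((\<lambda>w. theta (a * exp w) p) has_field_derivative
      deriv (\<lambda>u. theta u p) (a * exp w) * (a * exp w)) (at w)"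
    by (rule DERIV_chain2) (auto intro!: derivative_eq_intros)
  then show ?thesis
    using deriv_theta_nonzero[OF p _ zero] a DERIV_imp_deriv by fastforce
qed

text \<open>The argument \<open>x\<close> comes last because the proof of the three-term identity treats the difference of
  its two sides as a function of \<open>x\<close>.\<close>

definition weierstrass_defect :: "complex \<Rightarrow> complex \<Rightarrow> complex \<Rightarrow> complex \<Rightarrow> complex \<Rightarrow> complex" where
  "weierstrass_defect p y u v x =
     theta_pair p x y * theta_pair p u v - theta_pair p x v * theta_pair p u y
   - u / y * theta_pair p y v * theta_pair p x u"

lemma weierstrass_defect_mult_p:
  assumes "norm p < 1" "p \<noteq> 0" "y \<noteq> 0" "u \<noteq> 0" "v \<noteq> 0" "x \<noteq> 0"
  shows "weierstrass_defect p y u v (p * x) = inverse (x\<^sup>2) * weierstrass_defect p y u v x"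
  using assms by (simp add: weierstrass_defect_def theta_pair_mult_p right_diff_distrib mult_ac)

lemma weierstrass_defect_inverse:
  assumes "norm p < 1" "y \<noteq> 0" "u \<noteq> 0" "v \<noteq> 0" "x \<noteq> 0"
  shows "weierstrass_defect p y u v (1 / x) = inverse (x\<^sup>2) * weierstrass_defect p y u v x"
  using assms by (simp add: weierstrass_defect_def theta_pair_inverse right_diff_distrib mult_ac
      del: inverse_eq_divide)

text \<open>The hypotheses on \<open>v\<close> say that the zeros of \<open>\<theta>(xv)\<close> and of \<open>\<theta>(x/v)\<close> are disjoint, so that the
  zeros of their product are simple, and that this product does not vanish at \<open>x = y\<close>.\<close>

lemma theta_weierstrass_generic:
  assumes p: "norm p < 1" "p \<noteq> 0" and nz: "x \<noteq> 0" "y \<noteq> 0" "u \<noteq> 0" "v \<noteq> 0"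
    and gen: "theta (v * v) p \<noteq> 0" "theta (y * v) p \<noteq> 0" "theta (y / v) p \<noteq> 0"
  shows "weierstrass_defect p y u v x = 0"
proof -
  let ?F = "weierstrass_defect p y u v"
  define f where "f w = ?F (exp w)" for w
  define g1 where "g1 w = theta (v * exp w) p" for w
  define g2 where "g2 w = theta (1 / v * exp w) p" for w
  note quasi = weierstrass_defect_mult_p[OF p nz(2-4)]
  have diag: "theta_pair p b b = 0" if "b \<noteq> 0" for b
    using that theta_1[OF p(1)] by (simp add: theta_pair_def)
  have F_v: "?F v = 0"
    using theta_pair_commute[OF p(1) nz(2,4)] theta_pair_commute[OF p(1) nz(3,4)] diag nz
    by (simp add: weierstrass_defect_def)
  have F_y: "?F y = 0"
    using theta_pair_commute[OF p(1) nz(2,3)] diag nz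
    by (simp add: weierstrass_defect_def)
  have F_v': "?F (1 / v) = 0"
    using weierstrass_defect_inverse[OF p(1) nz(2-4) nz(4)] F_v by simp
  have zero1: "?F (p powi n * (1 / v)) = 0" and zero2: "?F (p powi n * v) = 0" for n
    by (rule quasiperiodic_zero_powi[where F = ?F and m = "\<lambda>x. inverse (x\<^sup>2)", OF p(2) quasi];
        use F_v F_v' nz in simp)+
  have hol1: "g1 holomorphic_on UNIV" and hol2: "g2 holomorphic_on UNIV"
    using theta_exp_holomorphic[OF p(1), of v] theta_exp_holomorphic[OF p(1), of "1 / v"] nz
    by (simp_all add: g1_def [abs_def] g2_def [abs_def])
  have holf: "f holomorphic_on UNIV"
    unfolding f_def weierstrass_defect_def theta_pair_def
    using nz by (intro holomorphic_intros theta_holomorphic p) auto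
  \<comment> \<open>Dividing by one theta function at a time reduces simplicity of the zeros to that of a single factor.\<close>
  obtain h1 where h1: "h1 holomorphic_on UNIV" "\<And>w. f w = g1 w * h1 w"
  proof (rule entire_quotient_of_simple_zeros[OF holf hol1])
    show "f w = 0" if z: "g1 w = 0" for w
    proof -
      obtain n where "v * exp w = p powi n"
        using z theta_eq_0_iff[OF p, of "v * exp w"] nz by (auto simp: g1_def)
      then have "exp w = p powi n * (1 / v)"
        using nz by (simp add: field_simps)
      then show ?thesis
        using zero1 by (simp add: f_def)
    qed
    show "deriv g1 w \<noteq> 0" if "g1 w = 0" for w
      using deriv_theta_exp_nonzero[OF p nz(4), of w] that by (simp add: g1_def [abs_def])
  qed blast
  obtain h where h: "h holomorphic_on UNIV" "\<And>w. h1 w = g2 w * h w"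
  proof (rule entire_quotient_of_simple_zeros[OF h1(1) hol2])
    show "h1 w = 0" if z: "g2 w = 0" for w
    proof -
      obtain n where n: "1 / v * exp w = p powi n"
        using z theta_eq_0_iff[OF p, of "1 / v * exp w"] nz by (auto simp: g2_def)
      then have e: "exp w = p powi n * v"
        using nz by (simp add: field_simps)
      have "g1 w \<noteq> 0"
      proof
        assume "g1 w = 0"
        then obtain m where "v * exp w = p powi m"
          using theta_eq_0_iff[OF p, of "v * exp w"] nz by (auto simp: g1_def)
        then have "v * v = p powi (m - n)"
          using e p by (simp add: power_int_diff field_simps)
        then show False
          using gen(1) theta_eq_0_iff[OF p, of "v * v"] nz(4) by (metis mult_eq_0_iff)
      qed
      then show ?thesis
        using h1(2)[of w] zero2[of n] e by (simp add: f_def)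
    qed
    show "deriv g2 w \<noteq> 0" if "g2 w = 0" for w
      using deriv_theta_exp_nonzero[OF p, of "1 / v" w] that nz by (simp add: g2_def [abs_def])
  qed blast
  have fh: "f w = g1 w * g2 w * h w" for w
    using h1(2) h(2) by simp
  \<comment> \<open>Since \<open>f\<close> and \<open>g1 * g2\<close> have the same multipliers, \<open>h\<close> is periodic off the zeros, hence everywhere.\<close>
  define S where "S = {w. theta (v * exp (1 * w)) p = 0} \<union> {w. theta (1 / v * exp (1 * w)) p = 0}"
  have S: "countable S"
    unfolding S_def using p nz by (intro countable_Un countable_theta_exp_zeros) auto
  have S_iff: "g1 w * g2 w \<noteq> 0" if "w \<notin> S" for w
    using that by (auto simp: S_def g1_def g2_def)
  have conth: "continuous_on UNIV h"
    using h(1) by (rule holomorphic_on_imp_continuous_on)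
  have shift: "continuous_on UNIV (\<lambda>w. h (w + b))" for b
    by (intro continuous_on_compose2[OF conth] continuous_intros) auto
  define c where "c = Ln p"
  have c: "exp c = p" "Re c < 0"
    using p by (simp_all add: c_def)
  have per1: "h (w + 2 * of_real pi * \<i>) = h w" for w
  proof (rule continuous_eq_off_countable[OF shift conth S])
    fix w assume w: "w \<notin> S"
    have "exp (w + 2 * of_real pi * \<i>) = exp w"
      by (simp add: exp_add)
    then show "h (w + 2 * of_real pi * \<i>) = h w"
      using fh[of "w + 2 * of_real pi * \<i>"] fh[of w] S_iff[OF w] by (simp add: f_def g1_def g2_def)
  qed
  have per2: "h (w + c) = h w" for w
  proof (rule continuous_eq_off_countable[OF shift conth S])
    fix w assume w: "w \<notin> S"
    have e: "exp (w + c) = p * exp w"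
      using c by (simp add: exp_add)
    have "f (w + c) = inverse ((exp w)\<^sup>2) * f w"
      using quasi[of "exp w"] by (simp add: f_def e)
    moreover have "g1 (w + c) * g2 (w + c) = inverse ((exp w)\<^sup>2) * (g1 w * g2 w)"
      using theta_pair_mult_p[OF p, of "exp w" v] nz
      by (simp add: theta_pair_def g1_def g2_def e divide_inverse mult_ac)
    ultimately have "inverse ((exp w)\<^sup>2) * (g1 w * g2 w) * h (w + c) = inverse ((exp w)\<^sup>2) * (g1 w * g2 w) * h w"
      using fh[of "w + c"] fh[of w] by simp
    then show "h (w + c) = h w"
      using S_iff[OF w] by simp
  qed
  obtain C where C: "\<And>w. h w = C"
    using entire_doubly_periodic_constant[OF h(1) c(2) per1 per2] by (auto simp: constant_on_def)
  have "g1 (Ln y) * g2 (Ln y) \<noteq> 0"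
    using gen nz by (simp add: g1_def g2_def mult.commute)
  moreover have "f (Ln y) = 0"
    using F_y nz by (simp add: f_def)
  ultimately have "C = 0"
    using fh[of "Ln y"] C by auto
  then show ?thesis
    using fh[of "Ln x"] C nz by (simp add: f_def)
qed

text \<open>Both sides are continuous in \<open>v = e\<^sup>w\<close>, and only countably many \<open>w\<close> are excluded from the generic case.\<close>

theorem theta_weierstrass:
  assumes p: "norm p < 1" "p \<noteq> 0" and nz: "x \<noteq> 0" "y \<noteq> 0" "u \<noteq> 0" "v \<noteq> 0"
  shows "theta_pair p x y * theta_pair p u v - theta_pair p x v * theta_pair p u y
       = u / y * theta_pair p y v * theta_pair p x u"
proof -
  define S where "S = {w. theta (1 * exp (2 * w)) p = 0} \<union> {w. theta (y * exp (1 * w)) p = 0}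
     \<union> {w. theta (y * exp ((-1) * w)) p = 0}"
  have S: "countable S"
    unfolding S_def using p nz by (intro countable_Un countable_theta_exp_zeros) auto
  have "weierstrass_defect p y u (exp (Ln v)) x = 0"
  proof (rule continuous_eq_off_countable[where f = "\<lambda>w. weierstrass_defect p y u (exp w) x"
        and g = "\<lambda>_. 0", OF _ _ S])
    show "continuous_on UNIV (\<lambda>w. weierstrass_defect p y u (exp w) x)"
      unfolding weierstrass_defect_def theta_pair_def
      using nz by (intro holomorphic_on_imp_continuous_on holomorphic_intros theta_holomorphic p) auto
    fix w assume "w \<notin> S"
    moreover have "exp (2 * w) = exp w * exp w"
      unfolding mult_2 by (rule exp_add)
    moreover have "y * exp ((-1) * w) = y / exp w"
      unfolding mult_minus1 exp_minus by (rule divide_inverse [symmetric])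
    ultimately have "theta (exp w * exp w) p \<noteq> 0" "theta (y * exp w) p \<noteq> 0" "theta (y / exp w) p \<noteq> 0"
      by (simp_all only: S_def Un_iff mem_Collect_eq de_Morgan_disj mult_1 not_False_eq_True)
    then show "weierstrass_defect p y u (exp w) x = 0"
      by (intro theta_weierstrass_generic p nz exp_not_eq_zero)
  qed (rule continuous_on_const)
  then show ?thesis
    using nz by (simp add: weierstrass_defect_def)
qed

section \<open>The three-term identity with mixed nomes\<close>

text \<open>The theta functions of nome \<open>r\<^sup>4\<close> have arguments that become squares once \<open>Y\<close> is written as \<open>- m\<^sup>2 L\<close>.
  Each of them then splits into two theta functions of nome \<open>r\<^sup>2\<close>, and the claim is the three-term identity of
  nome \<open>r\<^sup>2\<close>.\<close>

lemma theta_three_term_double_nome: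
  fixes r \<zeta> L Y :: complex
  assumes r: "norm r < 1" "r \<noteq> 0" and nz: "\<zeta> \<noteq> 0" "L \<noteq> 0" "Y \<noteq> 0"
  shows "theta (- r * L / \<zeta>) (r\<^sup>2) * theta (- r * Y * \<zeta>) (r\<^sup>2) * theta (- r\<^sup>2 * Y / (L * \<zeta>\<^sup>2)) (r ^ 4)
       - theta (- r * L * \<zeta>) (r\<^sup>2) * theta (- r * Y / \<zeta>) (r\<^sup>2) * theta (- r\<^sup>2 * Y * \<zeta>\<^sup>2 / L) (r ^ 4)
       = r * \<zeta> / L * theta (1 / \<zeta>\<^sup>2) (r\<^sup>2) * theta (L / Y) (r\<^sup>2) * theta (- Y * L) (r ^ 4)"
proof -
  define m where "m = csqrt (- Y / L)"
  have "m\<^sup>2 = - Y / L"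
    by (simp add: m_def)
  then have Y: "Y = - m\<^sup>2 * L" and m: "m \<noteq> 0"
    using nz by (auto simp: field_simps)
  have p: "norm (r\<^sup>2) < 1" "r\<^sup>2 \<noteq> 0"
    using r by (simp_all add: norm_power power_less_one_iff)
  have r4: "r ^ 4 = (r\<^sup>2)\<^sup>2"
    by simp
  note square = theta_square[OF p(1), folded r4]
  have sq1: "theta (- r\<^sup>2 * Y / (L * \<zeta>\<^sup>2)) (r ^ 4) = theta (r * m / \<zeta>) (r\<^sup>2) * theta (- r * \<zeta> / m) (r\<^sup>2)"
  proof -
    have "- r\<^sup>2 * Y / (L * \<zeta>\<^sup>2) = (r * m / \<zeta>)\<^sup>2" "r\<^sup>2 / - (r * m / \<zeta>) = - r * \<zeta> / m"
      using nz m r by (simp_all add: Y field_simps power2_eq_square)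
    then show ?thesis
      using square[of "r * m / \<zeta>"] theta_reflect[OF p(2), of "- (r * m / \<zeta>)"] by metis
  qed
  have sq2: "theta (- r\<^sup>2 * Y * \<zeta>\<^sup>2 / L) (r ^ 4) = theta (r * m * \<zeta>) (r\<^sup>2) * theta (- r / (m * \<zeta>)) (r\<^sup>2)"
  proof -
    have "- r\<^sup>2 * Y * \<zeta>\<^sup>2 / L = (r * m * \<zeta>)\<^sup>2" "r\<^sup>2 / - (r * m * \<zeta>) = - r / (m * \<zeta>)"
      using nz m r by (simp_all add: Y field_simps power2_eq_square)
    then show ?thesis
      using square[of "r * m * \<zeta>"] theta_reflect[OF p(2), of "- (r * m * \<zeta>)"] by metis
  qed
  have sq3: "theta (- Y * L) (r ^ 4) = m * L * (theta (m * L) (r\<^sup>2) * theta (- r\<^sup>2 * m * L) (r\<^sup>2))"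
  proof -
    have "- Y * L = (m * L)\<^sup>2" "- r\<^sup>2 * m * L = r\<^sup>2 * - (m * L)"
      by (simp_all add: Y power2_eq_square)
    then show ?thesis
      using square[of "m * L"] theta_mult_p[OF p(1) _ p(2), of "- (m * L)"] nz m
      by (simp add: mult.assoc)
  qed
  \<comment> \<open>The parameters of the three-term identity are \<open>x = \<i> r m L\<close>, \<open>y = \<i> / (m \<zeta>)\<close>, \<open>u = \<i> r\<close>, \<open>v = - \<i> m / \<zeta>\<close>.\<close>
  have x_y: "\<i> * r * m * L * (\<i> / (m * \<zeta>)) = - r * L / \<zeta>" "\<i> * r * m * L / (\<i> / (m * \<zeta>)) = - r * Y * \<zeta>"
    using nz m by (simp_all add: Y field_simps power2_eq_square)
  have u_v: "\<i> * r * (- \<i> * m / \<zeta>) = r * m / \<zeta>" "\<i> * r / (- \<i> * m / \<zeta>) = - r * \<zeta> / m"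
    using nz m by (simp_all add: field_simps)
  have x_v: "\<i> * r * m * L * (- \<i> * m / \<zeta>) = - r * Y / \<zeta>" "\<i> * r * m * L / (- \<i> * m / \<zeta>) = - r * L * \<zeta>"
    using nz m by (simp_all add: Y field_simps power2_eq_square)
  have u_y: "\<i> * r * (\<i> / (m * \<zeta>)) = - r / (m * \<zeta>)" "\<i> * r / (\<i> / (m * \<zeta>)) = r * m * \<zeta>"
    using nz m by (simp_all add: field_simps)
  have y_v: "\<i> / (m * \<zeta>) * (- \<i> * m / \<zeta>) = 1 / \<zeta>\<^sup>2" "\<i> / (m * \<zeta>) / (- \<i> * m / \<zeta>) = L / Y"
    using nz m by (simp_all add: Y field_simps power2_eq_square)
  have x_u: "\<i> * r * m * L * (\<i> * r) = - r\<^sup>2 * m * L" "\<i> * r * m * L / (\<i> * r) = m * L"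
    using r by (simp_all add: field_simps power2_eq_square)
  have "theta_pair (r\<^sup>2) (\<i> * r * m * L) (\<i> / (m * \<zeta>)) * theta_pair (r\<^sup>2) (\<i> * r) (- \<i> * m / \<zeta>)
     - theta_pair (r\<^sup>2) (\<i> * r * m * L) (- \<i> * m / \<zeta>) * theta_pair (r\<^sup>2) (\<i> * r) (\<i> / (m * \<zeta>))
     = \<i> * r / (\<i> / (m * \<zeta>)) * theta_pair (r\<^sup>2) (\<i> / (m * \<zeta>)) (- \<i> * m / \<zeta>)
         * theta_pair (r\<^sup>2) (\<i> * r * m * L) (\<i> * r)"
    by (rule theta_weierstrass[OF p]) (use nz m r in auto)
  then show ?thesis
    unfolding theta_pair_def x_y u_v x_v u_y y_v x_u sq1 sq2 sq3
    using nz by (simp add: mult_ac)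
qed

text \<open>Here the theta functions of nome \<open>r\<^sup>2\<close> are split into two of nome \<open>r\<^sup>4\<close>, and the claim is the
  three-term identity of nome \<open>r\<^sup>4\<close>.\<close>

lemma theta_three_term_half_nome:
  fixes r \<zeta> L X K :: complex
  assumes r: "norm r < 1" "r \<noteq> 0" and nz: "\<zeta> \<noteq> 0" "L \<noteq> 0" "X \<noteq> 0" "K \<noteq> 0"
  shows "theta (- r\<^sup>2 * K * L * X / \<zeta>\<^sup>2) (r ^ 4) * theta (- r\<^sup>2 * K * X / L) (r ^ 4) * theta (- r * X * \<zeta> / K) (r\<^sup>2)
       - theta (- r\<^sup>2 * L * X / K) (r ^ 4) * theta (- r * K * X / \<zeta>) (r\<^sup>2) * theta (- r\<^sup>2 * X * \<zeta>\<^sup>2 / (K * L)) (r ^ 4)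
       = - (r * \<zeta> / (K * X)) * theta (K\<^sup>2 / \<zeta>\<^sup>2) (r ^ 4) * theta (X\<^sup>2) (r ^ 4) * theta (r * L / \<zeta>) (r\<^sup>2)"
proof -
  have p: "norm (r\<^sup>2) < 1" "r\<^sup>2 \<noteq> 0" "norm (r ^ 4) < 1" "r ^ 4 \<noteq> 0"
    using r by (simp_all add: norm_power power_less_one_iff)
  have r4: "r ^ 4 = (r\<^sup>2)\<^sup>2"
    by simp
  note split = theta_even_odd[OF p(1,2), folded r4]
  note shift = theta_mult_p[OF p(3) _ p(4)]
  note reflect = theta_reflect[OF p(4)]
  have lower: "theta (- (w / r)) (r ^ 4) = w / r * theta (- (r / w)) (r ^ 4)" if "w \<noteq> 0" for w
    using shift[of "- (w / r)"] reflect[of "- (r / w)"] that r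
    by (simp add: field_simps power4_eq_xxxx)
  have halve: "theta (- (r * w)) (r\<^sup>2) = theta (- (r * w)) (r ^ 4) * theta (- (r / w)) (r ^ 4)"
      and halve': "theta (r * w) (r\<^sup>2) = theta (r * w) (r ^ 4) * theta (r / w) (r ^ 4)" if "w \<noteq> 0" for w
    using split[of "- (r * w)"] reflect[of "- (r / w)"] split[of "r * w"] reflect[of "r / w"] that r
    by (simp_all add: field_simps power4_eq_xxxx power2_eq_square)
  \<comment> \<open>With \<open>x = r\<close> and argument \<open>- r\<^sup>2 w\<close> the pair is a theta function of nome \<open>r\<^sup>2\<close> up to a monomial. The powers of
    \<open>r\<close> in \<open>y\<close> and \<open>u\<close> below are chosen for this.\<close>
  have pair: "theta_pair (r ^ 4) r (- r\<^sup>2 * w) = 1 / (r * w) * theta (- (r * w)) (r\<^sup>2)" if "w \<noteq> 0" for w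
  proof -
    have "r * (- r\<^sup>2 * w) = r ^ 4 / - (r / w)" "r / (- r\<^sup>2 * w) = - (1 / w / r)"
      using that r by (simp_all add: field_simps power4_eq_xxxx power2_eq_square)
    then show ?thesis
      using reflect[of "- (r / w)"] lower[of "1 / w"] halve[of w] that r
      by (simp add: theta_pair_def mult_ac)
  qed
  define x y u v where "x = r" and "y = - r\<^sup>2 * (X * \<zeta> / K)" and "u = - r\<^sup>2 * (K * X / \<zeta>)" and "v = \<zeta> / L"
  have xy: "theta_pair (r ^ 4) x y = K / (r * X * \<zeta>) * theta (- r * X * \<zeta> / K) (r\<^sup>2)"
    using pair[of "X * \<zeta> / K"] nz by (simp add: x_def y_def mult_ac)
  have uv: "theta_pair (r ^ 4) u v = theta (- r\<^sup>2 * K * X / L) (r ^ 4) * theta (- r\<^sup>2 * K * L * X / \<zeta>\<^sup>2) (r ^ 4)"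
    using nz by (simp add: theta_pair_def u_def v_def power2_eq_square mult_ac)
  have xv: "theta_pair (r ^ 4) x v = theta (r * L / \<zeta>) (r\<^sup>2)"
    using halve'[of "L / \<zeta>"] nz by (simp add: theta_pair_def x_def v_def mult_ac)
  have uy: "theta_pair (r ^ 4) u y = - (1 / X\<^sup>2) * theta (X\<^sup>2) (r ^ 4) * theta (K\<^sup>2 / \<zeta>\<^sup>2) (r ^ 4)"
    using shift[of "X\<^sup>2"] nz r
    by (simp add: theta_pair_def u_def y_def power2_eq_square power4_eq_xxxx mult_ac)
  have yv: "theta_pair (r ^ 4) y v
      = theta (- r\<^sup>2 * X * \<zeta>\<^sup>2 / (K * L)) (r ^ 4) * theta (- r\<^sup>2 * L * X / K) (r ^ 4)"
    using nz by (simp add: theta_pair_def y_def v_def power2_eq_square mult_ac)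
  have xu: "theta_pair (r ^ 4) x u = \<zeta> / (r * K * X) * theta (- r * K * X / \<zeta>) (r\<^sup>2)"
    using pair[of "K * X / \<zeta>"] nz by (simp add: x_def u_def mult_ac)
  have u_y: "u / y = K\<^sup>2 / \<zeta>\<^sup>2"
    using nz r by (simp add: u_def y_def power2_eq_square)
  have solve: "B * A * T - D * E * C = - (r * \<zeta> / (K * X)) * Q * S * R"
    if "K / (r * X * \<zeta>) * T * (A * B) - R * (- (1 / X\<^sup>2) * S * Q)
        = K\<^sup>2 / \<zeta>\<^sup>2 * (C * D) * (\<zeta> / (r * K * X) * E)" for A B C D E Q R S T
  proof -
    have "B * A * T - D * E * C + r * \<zeta> / (K * X) * Q * S * R
        = r * X * \<zeta> / K * (K / (r * X * \<zeta>) * T * (A * B) - R * (- (1 / X\<^sup>2) * S * Q)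
            - K\<^sup>2 / \<zeta>\<^sup>2 * (C * D) * (\<zeta> / (r * K * X) * E))"
      using nz r by (simp add: field_simps power2_eq_square)
    then show ?thesis
      using that by (simp add: add_eq_0_iff)
  qed
  have "theta_pair (r ^ 4) x y * theta_pair (r ^ 4) u v - theta_pair (r ^ 4) x v * theta_pair (r ^ 4) u y
      = u / y * theta_pair (r ^ 4) y v * theta_pair (r ^ 4) x u"
    by (rule theta_weierstrass[OF p(3,4)]) (use nz r in \<open>auto simp: x_def y_def u_def v_def\<close>)
  then show ?thesis
    unfolding xy uv xv uy yv xu u_y by (rule solve)
qed

section \<open>The two identities for theta quotients\<close>

text \<open>The following four definitions are the theta quotients of \<open>cJ\<close>, \<open>cJd\<close>, \<open>cR\<close> and \<open>cRd\<close> in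
  multiplicative variables, without the exponential factor \<open>W\<close>. In the dual functions \<open>X\<close> is the
  multiplicative form of the second argument, so that all four take \<open>X\<close> and \<open>\<zeta>\<close> in the same order.\<close>

definition cJ_theta :: "complex \<Rightarrow> complex \<Rightarrow> complex \<Rightarrow> complex \<Rightarrow> complex \<Rightarrow> complex" where
  "cJ_theta r K L X \<zeta> = thetas [K\<^sup>2 / \<zeta>\<^sup>2, - 1 / \<zeta>\<^sup>2, r\<^sup>2 * L\<^sup>2 / \<zeta>\<^sup>2, - r\<^sup>2 * X / (K * L * \<zeta>\<^sup>2)] (r ^ 4)
     / thetas [1 / \<zeta> ^ 4, - r\<^sup>2 * K * X / L] (r ^ 4)"

definition cJd_theta :: "complex \<Rightarrow> complex \<Rightarrow> complex \<Rightarrow> complex \<Rightarrow> complex \<Rightarrow> complex" where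
  "cJd_theta r K L X \<zeta> = thetas [K * L / X, - K / (L * X), r\<^sup>2 * K * L / X, - r\<^sup>2 * \<zeta>\<^sup>2 / (K * L * X)] (r ^ 4)
     / thetas [1 / X\<^sup>2, - r\<^sup>2 * \<zeta>\<^sup>2] (r ^ 4)"

definition cR_theta :: "complex \<Rightarrow> complex \<Rightarrow> complex \<Rightarrow> complex \<Rightarrow> complex \<Rightarrow> complex" where
  "cR_theta r K L X \<zeta> = thetas [K / \<zeta>, - K / \<zeta>, r * L / \<zeta>, - r * X / (K * \<zeta>)] (r\<^sup>2)
     / thetas [1 / \<zeta>\<^sup>2, - r * X] (r\<^sup>2)"

definition cRd_theta :: "complex \<Rightarrow> complex \<Rightarrow> complex \<Rightarrow> complex \<Rightarrow> complex \<Rightarrow> complex" where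
  "cRd_theta r K L X \<zeta> = thetas [K * L / X, - K / (L * X), r / X, - r * \<zeta> / (K * X)] (r\<^sup>2)
     / thetas [1 / X\<^sup>2, - r * L * \<zeta>] (r\<^sup>2)"

text \<open>These values are the factors that are cancelled or that remain as denominators in the two identities.
  By the doubling formulas, the theta functions of nome \<open>r\<^sup>4\<close> in the other denominators do not vanish
  either.\<close>

definition regular_point :: "complex \<Rightarrow> complex \<Rightarrow> complex \<Rightarrow> complex \<Rightarrow> complex \<Rightarrow> bool" where
  "regular_point r K L X \<zeta> \<longleftrightarrow>
     theta (\<zeta>\<^sup>2) (r\<^sup>2) \<noteq> 0 \<and> theta (- \<zeta>\<^sup>2) (r\<^sup>2) \<noteq> 0 \<and> theta (X\<^sup>2) (r\<^sup>2) \<noteq> 0 \<and>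
     theta (r * X) (r\<^sup>2) \<noteq> 0 \<and> theta (- r * X) (r\<^sup>2) \<noteq> 0 \<and> theta (- r * L * \<zeta>) (r\<^sup>2) \<noteq> 0 \<and>
     theta (K * L * X) (r\<^sup>2) \<noteq> 0 \<and> theta (- K * X / L) (r\<^sup>2) \<noteq> 0 \<and>
     theta (- r * X * \<zeta> / K) (r\<^sup>2) \<noteq> 0 \<and> theta (- r\<^sup>2 * X * \<zeta>\<^sup>2 / (K * L)) (r ^ 4) \<noteq> 0"

locale theta_quotients =
  fixes r K L X \<zeta> :: complex
  assumes r: "norm r < 1" "r \<noteq> 0"
    and nz: "K \<noteq> 0" "L \<noteq> 0" "X \<noteq> 0" "\<zeta> \<noteq> 0"
    and regular: "regular_point r K L X \<zeta>"
begin

lemma nome: "norm (r\<^sup>2) < 1" "r\<^sup>2 \<noteq> 0" "norm (r ^ 4) < 1" "r ^ 4 \<noteq> 0"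
  using r by (simp_all add: norm_power power_less_one_iff)

lemma split: "theta u (r\<^sup>2) = theta u (r ^ 4) * theta (r\<^sup>2 * u) (r ^ 4)"
  using theta_even_odd[OF nome(1,2), of u] by simp

lemma square: "theta (u\<^sup>2) (r ^ 4) = theta u (r\<^sup>2) * theta (- u) (r\<^sup>2)"
  using theta_square[OF nome(1), of u] by simp

lemmas regular_values = regular [unfolded regular_point_def]

lemma regular_inverse: "theta (1 / \<zeta>\<^sup>2) (r\<^sup>2) \<noteq> 0" "theta (- 1 / \<zeta>\<^sup>2) (r\<^sup>2) \<noteq> 0"
  using regular_values theta_inverse[OF nome(1), of "\<zeta>\<^sup>2"] theta_inverse[OF nome(1), of "- \<zeta>\<^sup>2"] nz by auto

lemma split_X: "theta (X\<^sup>2) (r\<^sup>2) = theta (X\<^sup>2) (r ^ 4) * (theta (r * X) (r\<^sup>2) * theta (- r * X) (r\<^sup>2))"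
  using split[of "X\<^sup>2"] square[of "r * X"] by (simp add: power_mult_distrib)

lemma cJd_theta_reflect:
  "cJd_theta r K L (1 / X) \<zeta> = theta (K * L * X) (r\<^sup>2) * theta (- K * X / L) (r ^ 4)
       * theta (- r\<^sup>2 * X * \<zeta>\<^sup>2 / (K * L)) (r ^ 4) / (theta (X\<^sup>2) (r ^ 4) * theta (- r\<^sup>2 * \<zeta>\<^sup>2) (r ^ 4))"
  unfolding split[of "K * L * X"] by (simp add: cJd_theta_def thetas_Cons thetas_Nil mult_1_right power_divide mult_ac)

lemma cRd_theta_reflect:
  "cRd_theta r K L (1 / X) \<zeta> = theta (K * L * X) (r\<^sup>2) * theta (- K * X / L) (r\<^sup>2)
       * theta (r * X) (r\<^sup>2) * theta (- r * X * \<zeta> / K) (r\<^sup>2) / (theta (X\<^sup>2) (r\<^sup>2) * theta (- r * L * \<zeta>) (r\<^sup>2))"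
  by (simp add: cRd_theta_def thetas_Cons thetas_Nil mult_1_right power_divide mult_ac)

lemma theta_reflect_zeta: "theta (- r\<^sup>2 / \<zeta>\<^sup>2) (r ^ 4) = theta (- r\<^sup>2 * \<zeta>\<^sup>2) (r ^ 4)"
proof -
  have "r ^ 4 / (- r\<^sup>2 * \<zeta>\<^sup>2) = - r\<^sup>2 / \<zeta>\<^sup>2"
    using r nz by (simp add: field_simps power2_eq_square power4_eq_xxxx)
  then show ?thesis
    using theta_reflect[OF nome(4), of "- r\<^sup>2 * \<zeta>\<^sup>2"] by simp
qed

lemma regular_factors: "theta (- r\<^sup>2 * \<zeta>\<^sup>2) (r ^ 4) \<noteq> 0" "theta (X\<^sup>2) (r ^ 4) \<noteq> 0" 
  "theta (- K * X / L) (r ^ 4) \<noteq> 0" "theta (- r\<^sup>2 * K * X / L) (r ^ 4) \<noteq> 0"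
  using regular_values split[of "- \<zeta>\<^sup>2"] split_X split[of "- K * X / L"] by (auto simp: mult_ac)

text \<open>The first identity needs \<open>\<eta> = 1 / \<zeta>\<close> and the second one \<open>\<eta> = \<zeta>\<close>. In both cases the factor
  \<open>\<theta>(- r\<^sup>2 \<zeta>\<^sup>2; r\<^sup>4)\<close> of the dual function, being invariant under \<open>\<zeta> \<mapsto> 1 / \<zeta>\<close>, combines with the
  numerator of \<open>cJ_theta\<close> to \<open>\<theta>(- 1 / \<eta>\<^sup>2; r\<^sup>2)\<close>, which cancels against one of the two factors of
  \<open>\<theta>(1 / \<eta>\<^sup>4; r\<^sup>4)\<close>.\<close>

lemma cJ_theta_over_dual:
  assumes \<eta>: "\<eta> = \<zeta> \<or> \<eta> = 1 / \<zeta>"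
  shows "cJ_theta r K L X \<eta> / cJd_theta r K L (1 / X) \<zeta> =
     theta (K\<^sup>2 / \<eta>\<^sup>2) (r ^ 4) * theta (r\<^sup>2 * L\<^sup>2 / \<eta>\<^sup>2) (r ^ 4) * theta (X\<^sup>2) (r ^ 4)
       * theta (- r\<^sup>2 * X / (K * L * \<eta>\<^sup>2)) (r ^ 4)
     / (theta (1 / \<eta>\<^sup>2) (r\<^sup>2) * theta (- K * X / L) (r\<^sup>2) * theta (K * L * X) (r\<^sup>2)
         * theta (- r\<^sup>2 * X * \<zeta>\<^sup>2 / (K * L)) (r ^ 4))"
proof -
  have sq: "theta (1 / \<eta> ^ 4) (r ^ 4) = theta (1 / \<eta>\<^sup>2) (r\<^sup>2) * theta (- 1 / \<eta>\<^sup>2) (r\<^sup>2)"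
    using square[of "1 / \<eta>\<^sup>2"] by (simp add: power_divide)
  have sp: "theta (- 1 / \<eta>\<^sup>2) (r\<^sup>2) = theta (- 1 / \<eta>\<^sup>2) (r ^ 4) * theta (- r\<^sup>2 * \<zeta>\<^sup>2) (r ^ 4)"
    using split[of "- 1 / \<eta>\<^sup>2"] theta_reflect_zeta \<eta> by (auto simp: power_divide)
  have sp': "theta (- K * X / L) (r\<^sup>2) = theta (- K * X / L) (r ^ 4) * theta (- r\<^sup>2 * K * X / L) (r ^ 4)"
    using split[of "- K * X / L"] by (simp add: mult_ac)
  have "theta (- 1 / \<eta>\<^sup>2) (r\<^sup>2) \<noteq> 0"
    using \<eta> regular_values regular_inverse by (auto simp: power_divide)
  then have nz1: "theta (- 1 / \<eta>\<^sup>2) (r ^ 4) \<noteq> 0"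
    unfolding sp by auto
  show ?thesis
    unfolding cJ_theta_def thetas_Cons thetas_Nil mult_1_right cJd_theta_reflect sq sp sp' using nz1 regular_factors
    by (simp add: mult_ac)
qed

lemma cR_theta_over_dual:
  "cR_theta r K L X \<eta> / cRd_theta r K L (1 / X) \<zeta> =
     theta (K\<^sup>2 / \<eta>\<^sup>2) (r ^ 4) * theta (r * L / \<eta>) (r\<^sup>2) * theta (- r * L * \<zeta>) (r\<^sup>2) * theta (X\<^sup>2) (r ^ 4)
       * theta (- r * X / (K * \<eta>)) (r\<^sup>2)
     / (theta (1 / \<eta>\<^sup>2) (r\<^sup>2) * theta (- K * X / L) (r\<^sup>2) * theta (K * L * X) (r\<^sup>2)
         * theta (- r * X * \<zeta> / K) (r\<^sup>2))"
proof -
  have sq: "theta (K\<^sup>2 / \<eta>\<^sup>2) (r ^ 4) = theta (K / \<eta>) (r\<^sup>2) * theta (- K / \<eta>) (r\<^sup>2)"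
    using square[of "K / \<eta>"] by (simp add: power_divide)
  show ?thesis
    unfolding cR_theta_def thetas_Cons thetas_Nil mult_1_right cRd_theta_reflect sq split_X using regular_values regular_factors
    by (simp add: mult_ac)
qed

lemma theta_square_inverse:
  "theta (1 / X\<^sup>2) (r ^ 4) = - theta (X\<^sup>2) (r ^ 4) / X\<^sup>2" "theta (1 / X\<^sup>2) (r\<^sup>2) = - theta (X\<^sup>2) (r\<^sup>2) / X\<^sup>2"
  using theta_inverse[OF nome(1), of "X\<^sup>2"] theta_inverse[OF nome(3), of "X\<^sup>2"] nz by simp_all

lemma cJd_theta_over_reflection:
  "cJd_theta r K L X \<zeta> / cJd_theta r K L (1 / X) \<zeta> =
     - X\<^sup>2 * theta (K * L / X) (r\<^sup>2) * theta (- K / (L * X)) (r ^ 4) * theta (- r\<^sup>2 * K * L * X / \<zeta>\<^sup>2) (r ^ 4)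
     / (theta (K * L * X) (r\<^sup>2) * theta (- K * X / L) (r ^ 4) * theta (- r\<^sup>2 * X * \<zeta>\<^sup>2 / (K * L)) (r ^ 4))"
proof -
  have "r ^ 4 / (- r\<^sup>2 * K * L * X / \<zeta>\<^sup>2) = - r\<^sup>2 * \<zeta>\<^sup>2 / (K * L * X)"
    using r nz by (simp add: field_simps power2_eq_square power4_eq_xxxx)
  then have ref: "theta (- r\<^sup>2 * \<zeta>\<^sup>2 / (K * L * X)) (r ^ 4) = theta (- r\<^sup>2 * K * L * X / \<zeta>\<^sup>2) (r ^ 4)"
    using theta_reflect[OF nome(4), of "- r\<^sup>2 * K * L * X / \<zeta>\<^sup>2"] by simp
  have sp: "theta (K * L / X) (r\<^sup>2) = theta (K * L / X) (r ^ 4) * theta (r\<^sup>2 * K * L / X) (r ^ 4)"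
    using split[of "K * L / X"] by (simp add: mult_ac)
  show ?thesis
    unfolding cJd_theta_reflect unfolding cJd_theta_def thetas_Cons thetas_Nil mult_1_right ref sp
    using regular_factors nz by (simp add: theta_square_inverse mult_ac)
qed

lemma cRd_theta_over_reflection:
  "cRd_theta r K L X \<zeta> / cRd_theta r K L (1 / X) \<zeta> =
     - X\<^sup>2 * theta (K * L / X) (r\<^sup>2) * (theta (- K / (L * X)) (r ^ 4) * theta (- r\<^sup>2 * L * X / K) (r ^ 4))
       * theta (- r * K * X / \<zeta>) (r\<^sup>2)
     / (theta (K * L * X) (r\<^sup>2) * theta (- K * X / L) (r\<^sup>2) * theta (- r * X * \<zeta> / K) (r\<^sup>2))"
proof -
  have "r\<^sup>2 / (- r * K * X / \<zeta>) = - r * \<zeta> / (K * X)" "r\<^sup>2 / (r * X) = r / X"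
      "r ^ 4 / (- r\<^sup>2 * L * X / K) = r\<^sup>2 * (- K / (L * X))"
    using r nz by (simp_all add: field_simps power2_eq_square power4_eq_xxxx)
  then have ref: "theta (- r * \<zeta> / (K * X)) (r\<^sup>2) = theta (- r * K * X / \<zeta>) (r\<^sup>2)"
      "theta (r / X) (r\<^sup>2) = theta (r * X) (r\<^sup>2)"
      "theta (- K / (L * X)) (r\<^sup>2) = theta (- K / (L * X)) (r ^ 4) * theta (- r\<^sup>2 * L * X / K) (r ^ 4)"
    using theta_reflect[OF nome(2), of "- r * K * X / \<zeta>"] theta_reflect[OF nome(2), of "r * X"]
      theta_reflect[OF nome(4), of "- r\<^sup>2 * L * X / K"] split[of "- K / (L * X)"] by simp_all
  show ?thesis
    unfolding cRd_theta_reflect unfolding cRd_theta_def thetas_Cons thetas_Nil mult_1_right ref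
    using regular_values nz by (simp add: theta_square_inverse mult_ac)
qed

text \<open>For \<open>\<eta> = 1 / \<zeta>\<close> the last theta functions in numerator and denominator cancel, both in
  \<open>cJ_theta_over_dual\<close> and in \<open>cR_theta_over_dual\<close>. What is left differs by a doubling formula.\<close>

theorem ratio_identity:
  "cJ_theta r K L X (1 / \<zeta>) / cJd_theta r K L (1 / X) \<zeta> = cR_theta r K L X (1 / \<zeta>) / cRd_theta r K L (1 / X) \<zeta>"
proof -
  have sq: "theta (r\<^sup>2 * L\<^sup>2 / (1 / \<zeta>)\<^sup>2) (r ^ 4) = theta (r * L / (1 / \<zeta>)) (r\<^sup>2) * theta (- r * L * \<zeta>) (r\<^sup>2)"
    using square[of "r * L * \<zeta>"] by (simp add: power_mult_distrib power_divide)
  have arg: "- r\<^sup>2 * X / (K * L * (1 / \<zeta>)\<^sup>2) = - r\<^sup>2 * X * \<zeta>\<^sup>2 / (K * L)" "- r * X / (K * (1 / \<zeta>)) = - r * X * \<zeta> / K"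
    by (simp_all add: power_divide)
  show ?thesis
    unfolding cJ_theta_over_dual[OF disjI2[OF refl]] cR_theta_over_dual sq arg using regular_values by simp
qed

text \<open>The identity is proved after moving the terms with \<open>cJ\<close> and \<open>cR\<close> to one side and the dual terms to
  the other. The mixed-nome identities turn each side into a single product.\<close>

theorem difference_identity:
  "(cJ_theta r K L X \<zeta> - cJd_theta r K L X \<zeta>) / cJd_theta r K L (1 / X) \<zeta>
     = (cR_theta r K L X \<zeta> - cRd_theta r K L X \<zeta>) / cRd_theta r K L (1 / X) \<zeta>"
proof -
  let ?t = "theta (K\<^sup>2 / \<zeta>\<^sup>2) (r ^ 4)" and ?S = "theta (X\<^sup>2) (r ^ 4)" and ?h = "theta (1 / \<zeta>\<^sup>2) (r\<^sup>2)"
    and ?G = "theta (K * L / X) (r\<^sup>2)" and ?M = "theta (- K / (L * X)) (r ^ 4)" and ?k = "theta (K * L * X) (r\<^sup>2)"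
    and ?n1 = "theta (- K * X / L) (r ^ 4)" and ?n2 = "theta (- r\<^sup>2 * K * X / L) (r ^ 4)"
    and ?E = "theta (- r\<^sup>2 * X * \<zeta>\<^sup>2 / (K * L)) (r ^ 4)" and ?F = "theta (- r * X * \<zeta> / K) (r\<^sup>2)"
    and ?R = "theta (r * L / \<zeta>) (r\<^sup>2)" and ?R' = "theta (- r * L / \<zeta>) (r\<^sup>2)"
    and ?Q = "theta (- r * L * \<zeta>) (r\<^sup>2)" and ?A = "theta (- r\<^sup>2 * X / (K * L * \<zeta>\<^sup>2)) (r ^ 4)"
    and ?B = "theta (- r * X / (K * \<zeta>)) (r\<^sup>2)" and ?A' = "theta (- r\<^sup>2 * K * L * X / \<zeta>\<^sup>2) (r ^ 4)"
    and ?C = "theta (- r\<^sup>2 * L * X / K) (r ^ 4)" and ?D = "theta (- r * K * X / \<zeta>) (r\<^sup>2)"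
  have "theta (- (X / K) * L) (r ^ 4) = X * L / K * ?M"
    using theta_inverse[OF nome(3), of "- K / (L * X)"] nz by (simp add: mult.commute)
  then have three1: "?R' * ?F * ?A - ?Q * ?B * ?E = r * \<zeta> * X / K * ?h * ?G * ?M"
    using theta_three_term_double_nome[OF r, of \<zeta> L "X / K"] nz by (simp add: mult_ac)
  have three2: "?A' * ?n2 * ?F - ?C * ?D * ?E = - (r * \<zeta> / (K * X)) * ?t * ?S * ?R"
    using theta_three_term_half_nome[OF r, of \<zeta> L X K] nz by simp
  have n: "theta (- K * X / L) (r\<^sup>2) = ?n1 * ?n2"
    using split[of "- K * X / L"] by (simp add: mult_ac)
  have RR': "theta (r\<^sup>2 * L\<^sup>2 / \<zeta>\<^sup>2) (r ^ 4) = ?R * ?R'"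
    using square[of "r * L / \<zeta>"] by (simp add: power_mult_distrib power_divide)
  have nonzero: "?h \<noteq> 0" "?k \<noteq> 0" "?n1 \<noteq> 0" "?n2 \<noteq> 0" "?E \<noteq> 0" "?F \<noteq> 0"
    using regular_values regular_inverse regular_factors by blast+
  have "cJ_theta r K L X \<zeta> / cJd_theta r K L (1 / X) \<zeta> - cR_theta r K L X \<zeta> / cRd_theta r K L (1 / X) \<zeta>
      = ?t * ?R * ?S / (?h * ?n1 * ?n2 * ?k * ?E * ?F) * (?R' * ?F * ?A - ?Q * ?B * ?E)"
    unfolding cJ_theta_over_dual[OF disjI1[OF refl]] cR_theta_over_dual n RR'
    using nonzero by (simp add: divide_simps) (simp add: algebra_simps)
  also have "\<dots> = ?t * ?R * ?S * (r * \<zeta> * X / K) * ?G * ?M / (?n1 * ?n2 * ?k * ?E * ?F)"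
    unfolding three1 using nonzero by (simp add: mult_ac)
  also have "\<dots> = - X\<^sup>2 * ?G * ?M / (?n1 * ?n2 * ?k * ?E * ?F) * (?A' * ?n2 * ?F - ?C * ?D * ?E)"
    unfolding three2 using nz by (simp add: power2_eq_square mult_ac)
  also have "\<dots> = cJd_theta r K L X \<zeta> / cJd_theta r K L (1 / X) \<zeta> - cRd_theta r K L X \<zeta> / cRd_theta r K L (1 / X) \<zeta>"
    unfolding cJd_theta_over_reflection cRd_theta_over_reflection n
    using nonzero by (simp add: divide_simps) (simp add: algebra_simps)
  finally show ?thesis
    by (simp add: diff_divide_distrib algebra_simps)
qed

end

section \<open>The c-functions as theta quotients\<close>

lemma qpow_add: "qpow \<tau> (a + b) = qpow \<tau> a * qpow \<tau> b"
  by (simp add: qpow_def distrib_left exp_add)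

lemma qpow_minus: "qpow \<tau> (- a) = 1 / qpow \<tau> a"
  by (simp add: qpow_def exp_minus divide_inverse)

lemma qpow_diff: "qpow \<tau> (a - b) = qpow \<tau> a / qpow \<tau> b"
  by (simp add: qpow_def right_diff_distrib exp_diff)

lemma qpow_0 [simp]: "qpow \<tau> 0 = 1"
  by (simp add: qpow_def)

lemma qpow_nonzero [simp]: "qpow \<tau> a \<noteq> 0"
  by (simp add: qpow_def)

lemma qpow_power: "qpow \<tau> a ^ n = qpow \<tau> (of_nat n * a)"
  by (simp add: qpow_def mult_ac flip: exp_of_nat_mult)

lemma qpow_norm_less_1:
  assumes "Re \<tau> = 0" "Im \<tau> > 0" "s > 0"
  shows "norm (qpow \<tau> (of_real s)) < 1"
  using assms by (simp add: qpow_def)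

text \<open>This form isolates the arguments of the theta functions, so that each can be compared separately.\<close>

lemma cfun_eqI:
  assumes "qpow \<tau> (of_real s) = p"
    and "qpow \<tau> (of_real (\<kappa> + \<upsilon>)) * qpow \<tau> (- z) = a"
    and "- qpow \<tau> (of_real (\<kappa> - \<upsilon>)) * qpow \<tau> (- z) = b"
    and "qpow \<tau> (of_real (s / 2 + lam + \<sigma>)) * qpow \<tau> (- z) = c"
    and "- qpow \<tau> (of_real (s / 2 + \<upsilon> - \<sigma>)) * qpow \<tau> (x - z) / qpow \<tau> (of_real (\<kappa> + \<upsilon>)) = d"
    and "qpow \<tau> (- 2 * z) = e"
    and "- qpow \<tau> (of_real (s / 2 + \<upsilon> - \<sigma>)) * qpow \<tau> x = f"
    and "(of_real (\<kappa> + lam) + x) * (of_real (\<kappa> + \<upsilon>) + z) / of_real s = w"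
  shows "cfun \<tau> s \<kappa> lam \<upsilon> \<sigma> x z = thetas [a, b, c, d] p / thetas [e, f] p / qpow \<tau> w"
  unfolding cfun_def Let_def assms by (simp add: mult.commute)

text \<open>The common exponent of the factors \<open>W\<close> of all four functions, with \<open>x\<close> and \<open>z\<close> the variables of the
  theorem.\<close>

definition weight_exponent :: "real \<Rightarrow> real \<Rightarrow> real \<Rightarrow> complex \<Rightarrow> complex \<Rightarrow> complex" where
  "weight_exponent s \<kappa> lam x z = (of_real (\<kappa> + lam) + x) * (of_real (2 * \<kappa>) + z) / of_real s"

lemmas qpow_simps = of_real_add of_real_diff qpow_add qpow_diff qpow_minus
  power2_eq_square power4_eq_xxxx

text \<open>In \<open>cR\<close> and \<open>cRd\<close> the halved step size compensates the halved variable \<open>z\<close> in the exponent of \<open>W\<close>,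
  which is why the weight is the same for all four functions.\<close>

lemma c_functions_as_theta_quotients:
  fixes \<tau> x z :: complex and s \<kappa> lam :: real
  defines "r \<equiv> qpow \<tau> (of_real (s / 4))" and "K \<equiv> qpow \<tau> (of_real \<kappa>)" and "L \<equiv> qpow \<tau> (of_real lam)"
    and "X \<equiv> qpow \<tau> x" and "\<zeta> \<equiv> qpow \<tau> (z / 2)" and "W \<equiv> qpow \<tau> (weight_exponent s \<kappa> lam x z)"
  shows "cJ \<tau> s \<kappa> lam x z = cJ_theta r K L X \<zeta> / W"
    and "cJd \<tau> s \<kappa> lam z x = cJd_theta r K L X \<zeta> / W"
    and "cR \<tau> s \<kappa> lam x z = cR_theta r K L X \<zeta> / W"
    and "cRd \<tau> s \<kappa> lam (z / 2) (2 * x) = cRd_theta r K L X \<zeta> / W"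
proof -
  have q_s: "qpow \<tau> (of_real s) = r ^ 4" "qpow \<tau> (of_real (s / 2)) = r\<^sup>2" "qpow \<tau> (of_real (s / 2 / 2)) = r"
    and q_z: "qpow \<tau> z = \<zeta>\<^sup>2" "qpow \<tau> (- 2 * z) = 1 / \<zeta> ^ 4" "qpow \<tau> (- 2 * (z / 2)) = 1 / \<zeta>\<^sup>2"
      "qpow \<tau> (- 2 * x) = 1 / X\<^sup>2"
    by (simp_all add: r_def \<zeta>_def X_def qpow_power flip: qpow_minus)
  have half: "2 * x / 2 = x"
    by simp
  have nz: "r \<noteq> 0" "K \<noteq> 0" "L \<noteq> 0" "X \<noteq> 0" "\<zeta> \<noteq> 0"
    by (simp_all add: r_def K_def L_def X_def \<zeta>_def)
  have w: "(of_real (\<kappa> + lam) + x) * (of_real (\<kappa> + \<kappa>) + z) / of_real s = weight_exponent s \<kappa> lam x z"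
      "(of_real (\<kappa> + \<kappa>) + z) * (of_real (\<kappa> + lam) + x) / of_real s = weight_exponent s \<kappa> lam x z"
      "(of_real (\<kappa> + lam) + x) * (of_real (\<kappa> + 0) + z / 2) / of_real (s / 2) = weight_exponent s \<kappa> lam x z"
      "(of_real (\<kappa> + 0) + z / 2) * (of_real (\<kappa> + lam) + x) / of_real (s / 2) = weight_exponent s \<kappa> lam x z"
    by (cases "s = 0"; simp add: weight_exponent_def field_simps)+
  note fold = K_def [symmetric] L_def [symmetric] X_def [symmetric] \<zeta>_def [symmetric]
  show "cJ \<tau> s \<kappa> lam x z = cJ_theta r K L X \<zeta> / W"
    unfolding cJ_def cJ_theta_def W_def
    by (rule cfun_eqI; (rule w | simp only: qpow_simps q_s q_z fold)?)
       (use nz in \<open>simp_all add: field_simps\<close>)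
  show "cJd \<tau> s \<kappa> lam z x = cJd_theta r K L X \<zeta> / W"
    unfolding cJd_def cJd_theta_def W_def
    by (rule cfun_eqI; (rule w | simp only: qpow_simps q_s q_z fold)?)
       (use nz in \<open>simp_all add: field_simps\<close>)
  show "cR \<tau> s \<kappa> lam x z = cR_theta r K L X \<zeta> / W"
    unfolding cR_def cR_theta_def W_def
    by (rule cfun_eqI; (rule w | simp only: qpow_simps q_s q_z fold)?)
       (use nz in \<open>simp_all add: field_simps\<close>)
  show "cRd \<tau> s \<kappa> lam (z / 2) (2 * x) = cRd_theta r K L X \<zeta> / W"
    unfolding cRd_def half cRd_theta_def W_def
    by (rule cfun_eqI; (rule w | simp only: qpow_simps q_s q_z fold)?)
       (use nz in \<open>simp_all add: field_simps\<close>)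
qed

section \<open>Generic points and meromorphic functions of two variables\<close>

text \<open>Equality of meromorphic functions is generic equality of representatives. Openness is what makes this
  notion closed under conjunction.\<close>

definition generic :: "(complex \<times> complex \<Rightarrow> bool) \<Rightarrow> bool" where
  "generic P \<longleftrightarrow> (\<exists>V. open V \<and> closure V = UNIV \<and> (\<forall>w\<in>V. P w))"

lemma generic_mono: "generic P \<Longrightarrow> (\<And>w. P w \<Longrightarrow> Q w) \<Longrightarrow> generic Q"
  unfolding generic_def by blast

lemma generic_conj:
  assumes "generic P" "generic Q"
  shows "generic (\<lambda>w. P w \<and> Q w)"
proof -
  obtain V W where V: "open V" "closure V = UNIV" "\<And>w. w \<in> V \<Longrightarrow> P w"
      and W: "open W" "closure W = UNIV" "\<And>w. w \<in> W \<Longrightarrow> Q w"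
    using assms unfolding generic_def by blast
  have "closure (V \<inter> W) = UNIV"
    using closure_open_Int_superset[of V W] V W by simp
  then show ?thesis
    unfolding generic_def using V W by (intro exI[of _ "V \<inter> W"]) auto
qed

abbreviation "entire2 F \<equiv> holomorphic2_on F UNIV"

lemma entire2I:
  "(\<And>w. \<exists>a b. (F has_derivative (\<lambda>v. a * fst v + b * snd v)) (at w)) \<Longrightarrow> entire2 F"
  by (simp add: holomorphic2_on_def)

lemma entire2D:
  assumes "entire2 F"
  obtains a b where "(F has_derivative (\<lambda>v. a * fst v + b * snd v)) (at w)"
  using assms that unfolding holomorphic2_on_def by blast

lemma entire2_continuous: "entire2 F \<Longrightarrow> continuous_on UNIV F"
  by (metis continuous_at_imp_continuous_on entire2D has_derivative_continuous)

lemma entire2_linear: "entire2 (\<lambda>w. \<alpha> * fst w + \<beta> * snd w + \<gamma>)"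
  by (rule entire2I, rule exI[of _ \<alpha>], rule exI[of _ \<beta>]) (auto intro!: derivative_eq_intros)

lemma entire2_compose:
  assumes F: "entire2 F" and f: "f holomorphic_on UNIV"
  shows "entire2 (\<lambda>w. f (F w))"
proof (rule entire2I)
  fix w
  obtain a b where D: "(F has_derivative (\<lambda>v. a * fst v + b * snd v)) (at w)"
    using F by (rule entire2D)
  have "(f has_derivative (*) (deriv f (F w))) (at (F w))"
    using holomorphic_derivI[OF f, of "F w"] by (simp add: has_field_derivative_def)
  from has_derivative_compose[OF D this]
  have "((\<lambda>w. f (F w)) has_derivative (\<lambda>v. (deriv f (F w) * a) * fst v + (deriv f (F w) * b) * snd v)) (at w)"
    by (simp add: algebra_simps)
  then show "\<exists>a b. ((\<lambda>w. f (F w)) has_derivative (\<lambda>v. a * fst v + b * snd v)) (at w)"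
    by blast
qed

lemma entire2_mult:
  assumes F: "entire2 F" and G: "entire2 G"
  shows "entire2 (\<lambda>w. F w * G w)"
proof (rule entire2I)
  fix w
  obtain a b where D: "(F has_derivative (\<lambda>v. a * fst v + b * snd v)) (at w)"
    using F by (rule entire2D)
  obtain c d where E: "(G has_derivative (\<lambda>v. c * fst v + d * snd v)) (at w)"
    using G by (rule entire2D)
  have "((\<lambda>w. F w * G w) has_derivative (\<lambda>v. (F w * c + a * G w) * fst v + (F w * d + b * G w) * snd v)) (at w)"
    using has_derivative_mult[OF D E] by (simp add: algebra_simps)
  then show "\<exists>a b. ((\<lambda>w. F w * G w) has_derivative (\<lambda>v. a * fst v + b * snd v)) (at w)"
    by blast
qed

lemma entire2_diff:
  assumes F: "entire2 F" and G: "entire2 G"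
  shows "entire2 (\<lambda>w. F w - G w)"
proof (rule entire2I)
  fix w
  obtain a b where D: "(F has_derivative (\<lambda>v. a * fst v + b * snd v)) (at w)"
    using F by (rule entire2D)
  obtain c d where E: "(G has_derivative (\<lambda>v. c * fst v + d * snd v)) (at w)"
    using G by (rule entire2D)
  have "((\<lambda>w. F w - G w) has_derivative (\<lambda>v. (a - c) * fst v + (b - d) * snd v)) (at w)"
    using has_derivative_diff[OF D E] by (simp add: algebra_simps)
  then show "\<exists>a b. ((\<lambda>w. F w - G w) has_derivative (\<lambda>v. a * fst v + b * snd v)) (at w)"
    by blast
qed

text \<open>A global form of \<open>meromorphic2\<close>. With it, closure under differences and quotients is a
  calculation with fractions.\<close>

definition entire_quotient :: "(complex \<times> complex \<Rightarrow> complex) \<Rightarrow> bool" where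
  "entire_quotient F \<longleftrightarrow> (\<exists>N D. entire2 N \<and> entire2 D \<and> generic (\<lambda>w. D w \<noteq> 0) \<and>
     (\<forall>w. D w \<noteq> 0 \<longrightarrow> F w = N w / D w))"

lemma entire_quotientI:
  assumes "entire2 N" "entire2 D" "generic (\<lambda>w. D w \<noteq> 0)"
  shows "entire_quotient (\<lambda>w. N w / D w)"
  unfolding entire_quotient_def using assms by blast

lemma entire_quotient_diff:
  assumes "entire_quotient F" "entire_quotient G"
  shows "entire_quotient (\<lambda>w. F w - G w)"
proof -
  obtain N D where F: "entire2 N" "entire2 D" "generic (\<lambda>w. D w \<noteq> 0)" "\<And>w. D w \<noteq> 0 \<Longrightarrow> F w = N w / D w"
    using assms(1) by (auto simp: entire_quotient_def)
  obtain N' D' where G: "entire2 N'" "entire2 D'" "generic (\<lambda>w. D' w \<noteq> 0)" "\<And>w. D' w \<noteq> 0 \<Longrightarrow> G w = N' w / D' w"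
    using assms(2) by (auto simp: entire_quotient_def)
  have "generic (\<lambda>w. D w * D' w \<noteq> 0)"
    using generic_conj[OF F(3) G(3)] by simp
  moreover have "F w - G w = (N w * D' w - N' w * D w) / (D w * D' w)" if "D w * D' w \<noteq> 0" for w
    using that F(4)[of w] G(4)[of w] by (simp add: field_simps)
  ultimately show ?thesis
    unfolding entire_quotient_def using F G
    by (intro exI[of _ "\<lambda>w. N w * D' w - N' w * D w"] exI[of _ "\<lambda>w. D w * D' w"] conjI entire2_mult entire2_diff) auto
qed

text \<open>The denominator \<open>D'\<close> of \<open>G\<close> is kept as a factor of the new denominator, so that the representation
  of \<open>G\<close> is available wherever that denominator is nonzero.\<close>

lemma entire_quotient_divide:
  assumes "entire_quotient F" "entire_quotient G" "generic (\<lambda>w. G w \<noteq> 0)"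
  shows "entire_quotient (\<lambda>w. F w / G w)"
proof -
  obtain N D where F: "entire2 N" "entire2 D" "generic (\<lambda>w. D w \<noteq> 0)" "\<And>w. D w \<noteq> 0 \<Longrightarrow> F w = N w / D w"
    using assms(1) by (auto simp: entire_quotient_def)
  obtain N' D' where G: "entire2 N'" "entire2 D'" "generic (\<lambda>w. D' w \<noteq> 0)" "\<And>w. D' w \<noteq> 0 \<Longrightarrow> G w = N' w / D' w"
    using assms(2) by (auto simp: entire_quotient_def)
  have "generic (\<lambda>w. D w * (D' w * N' w) \<noteq> 0)"
    using generic_conj[OF F(3) generic_conj[OF G(3) assms(3)]] by (rule generic_mono) (use G(4) in auto)
  moreover have "F w / G w = (N w * (D' w * D' w)) / (D w * (D' w * N' w))" if "D w * (D' w * N' w) \<noteq> 0" for w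
    using that by (simp add: F(4) G(4))
  ultimately show ?thesis
    unfolding entire_quotient_def using F G
    by (intro exI[of _ "\<lambda>w. N w * (D' w * D' w)"] exI[of _ "\<lambda>w. D w * (D' w * N' w)"] conjI entire2_mult) auto
qed

lemma entire_quotient_meromorphic2:
  assumes "entire_quotient F"
  shows "meromorphic2 F"
proof -
  obtain N D where F: "entire2 N" "entire2 D" "generic (\<lambda>w. D w \<noteq> 0)" "\<And>w. D w \<noteq> 0 \<Longrightarrow> F w = N w / D w"
    using assms by (auto simp: entire_quotient_def)
  obtain V where V: "closure V = UNIV" "V \<subseteq> {v. D v \<noteq> 0}"
    using F(3) unfolding generic_def by blast
  then have "UNIV \<subseteq> closure {v \<in> UNIV. D v \<noteq> 0}"
    using closure_mono[OF V(2)] by simp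
  then show ?thesis
    unfolding meromorphic2_def using F by blast
qed

lemma meromorphic2_eqI:
  assumes "entire_quotient F" "entire_quotient G" "generic (\<lambda>w. F w = G w)"
  shows "meromorphic2_eq F G"
  using assms entire_quotient_meromorphic2 by (auto simp: meromorphic2_eq_def generic_def)

section \<open>The c-functions as meromorphic functions\<close>

lemma entire2_qpow:
  assumes "entire2 G"
  shows "entire2 (\<lambda>w. qpow \<tau> (G w))"
  by (rule entire2_compose[where f = "qpow \<tau>", OF assms]) (unfold qpow_def [abs_def], intro holomorphic_intros)

lemma entire2_theta_qpow:
  assumes G: "entire2 G" and p: "norm p < 1" and a: "a \<noteq> 0"
  shows "entire2 (\<lambda>w. theta (a * qpow \<tau> (G w)) p)"
  by (rule entire2_compose[where f = "\<lambda>y. theta (a * qpow \<tau> y) p", OF G])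
     (use a in \<open>auto simp: qpow_def intro!: theta_holomorphic p holomorphic_intros\<close>)

text \<open>Through every point there is a complex line on which the linear form is not constant. The zeros on this
  line are countable, so every point is a limit of points where the function does not vanish.\<close>

lemma generic_theta_qpow:
  assumes p: "norm p < 1" "p \<noteq> 0" and a: "a \<noteq> 0" and \<tau>: "\<tau> \<noteq> 0" and lin: "\<alpha> \<noteq> 0 \<or> \<beta> \<noteq> 0"
  shows "generic (\<lambda>w. theta (a * qpow \<tau> (\<alpha> * fst w + \<beta> * snd w)) p \<noteq> 0)"
proof -
  let ?D = "\<lambda>w. theta (a * qpow \<tau> (\<alpha> * fst w + \<beta> * snd w)) p"
  let ?V = "{w. ?D w \<noteq> 0}"
  have "entire2 ?D"
    using entire2_theta_qpow[OF entire2_linear[of \<alpha> \<beta> 0] p(1) a] by simp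
  then have "open ?V"
    by (intro open_Collect_neq entire2_continuous continuous_on_const)
  moreover have "w0 \<in> closure ?V" for w0
  proof -
    \<comment> \<open>In the conjugate direction the linear form grows at the rate \<open>\<bar>\<alpha>\<bar>\<^sup>2 + \<bar>\<beta>\<bar>\<^sup>2\<close>, which is not zero.\<close>
    define line where "line t = (fst w0 + t * cnj \<alpha>, snd w0 + t * cnj \<beta>)" for t
    define k where "k = \<alpha> * cnj \<alpha> + \<beta> * cnj \<beta>"
    have "k = of_real ((norm \<alpha>)\<^sup>2 + (norm \<beta>)\<^sup>2)"
      by (simp only: k_def of_real_add complex_norm_square)
    then have "k \<noteq> 0"
      using lin by (simp only: of_real_eq_0_iff) (auto simp: add_nonneg_eq_0_iff)
    define b where "b = a * qpow \<tau> (\<alpha> * fst w0 + \<beta> * snd w0)"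
    define S where "S = {t. theta (b * exp (2 * of_real pi * \<i> * \<tau> * k * t)) p = 0}"
    have "a * qpow \<tau> (\<alpha> * fst (line t) + \<beta> * snd (line t)) = b * exp (2 * of_real pi * \<i> * \<tau> * k * t)" for t
      by (simp add: b_def k_def line_def qpow_def algebra_simps flip: exp_add)
    then have image: "line ` (- S) \<subseteq> ?V"
      by (auto simp: S_def)
    have "countable S"
      unfolding S_def using p a \<tau> \<open>k \<noteq> 0\<close> by (intro countable_theta_exp_zeros) (auto simp: b_def)
    then have "0 \<in> closure (- S)"
      by (simp add: closure_Compl_countable)
    moreover have "line ` closure (- S) \<subseteq> closure ?V"
    proof (rule image_closure_subset)
      show "continuous_on (closure (- S)) line"
        unfolding line_def [abs_def] by (intro continuous_intros)
      show "line ` (- S) \<subseteq> closure ?V"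
        using image closure_subset by (rule subset_trans)
    qed simp
    ultimately show ?thesis
      by (force simp: line_def)
  qed
  ultimately show ?thesis
    unfolding generic_def by (intro exI[of _ ?V]) auto
qed

text \<open>The linear conditions say that \<open>x\<close>, \<open>z\<close> and \<open>x - z\<close>, the forms that occur inside the theta functions,
  are not constant after the substitution.\<close>

lemma cfun_entire_quotient_generic_nonzero:
  fixes \<tau> \<alpha> \<beta> \<gamma> \<delta> :: complex and s \<kappa> lam \<upsilon> \<sigma> :: real
  assumes \<tau>: "Re \<tau> = 0" "Im \<tau> > 0" "s > 0"
    and lin: "\<alpha> \<noteq> 0 \<or> \<beta> \<noteq> 0" "\<gamma> \<noteq> 0 \<or> \<delta> \<noteq> 0" "\<alpha> \<noteq> \<gamma> \<or> \<beta> \<noteq> \<delta>"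
  defines "F \<equiv> \<lambda>w. cfun \<tau> s \<kappa> lam \<upsilon> \<sigma> (\<alpha> * fst w + \<beta> * snd w) (\<gamma> * fst w + \<delta> * snd w)"
  shows "entire_quotient F" and "generic (\<lambda>w. F w \<noteq> 0)"
proof -
  define p where "p = qpow \<tau> (of_real s)"
  have p: "norm p < 1" "p \<noteq> 0"
    using qpow_norm_less_1[OF \<tau>] by (simp_all add: p_def)
  have \<tau>0: "\<tau> \<noteq> 0"
    using \<tau> by auto
  define a b c d where "a = qpow \<tau> (of_real (\<kappa> + \<upsilon>))" and "b = - qpow \<tau> (of_real (\<kappa> - \<upsilon>))"
    and "c = qpow \<tau> (of_real (s / 2 + lam + \<sigma>))" and "d = - qpow \<tau> (of_real (s / 2 + \<upsilon> - \<sigma>))"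
  have nz: "a \<noteq> 0" "b \<noteq> 0" "c \<noteq> 0" "d \<noteq> 0" "d / a \<noteq> 0"
    by (simp_all add: a_def b_def c_def d_def)
  define T where "T u \<mu> \<nu> w = theta (u * qpow \<tau> (\<mu> * fst w + \<nu> * snd w)) p" for u \<mu> \<nu> and w :: "complex \<times> complex"
  define N where "N w = T a (- \<gamma>) (- \<delta>) w * (T b (- \<gamma>) (- \<delta>) w * (T c (- \<gamma>) (- \<delta>) w
      * T (d / a) (\<alpha> - \<gamma>) (\<beta> - \<delta>) w))" for w
  define W where "W w = qpow \<tau> ((of_real (\<kappa> + lam) + (\<alpha> * fst w + \<beta> * snd w)) *
      (of_real (\<kappa> + \<upsilon>) + (\<gamma> * fst w + \<delta> * snd w)) / of_real s)" for w
  define D where "D w = W w * (T 1 (- 2 * \<gamma>) (- 2 * \<delta>) w * T d \<alpha> \<beta> w)" for w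
  have F: "F w = N w / D w" for w
    unfolding F_def cfun_def Let_def N_def D_def W_def [symmetric] T_def thetas_Cons thetas_Nil mult_1_right
      p_def [symmetric] a_def [symmetric] b_def [symmetric] c_def [symmetric] d_def [symmetric]
    by (simp add: algebra_simps)
  have W: "entire2 W"
  proof -
    have "entire2 (\<lambda>w. (\<alpha> * fst w + \<beta> * snd w + of_real (\<kappa> + lam)) *
        ((\<gamma> * fst w + \<delta> * snd w + of_real (\<kappa> + \<upsilon>)) * (0 * fst w + 0 * snd w + 1 / of_real s)))"
      by (intro entire2_mult entire2_linear)
    from entire2_qpow[OF this, of \<tau>] show ?thesis
      by (simp add: W_def [abs_def] add.commute)
  qed
  have T: "entire2 (T u \<mu> \<nu>)" if "u \<noteq> 0" for u \<mu> \<nu>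
    using entire2_theta_qpow[OF entire2_linear[of \<mu> \<nu> 0] p(1) that] by (simp add: T_def [abs_def])
  have gen: "generic (\<lambda>w. T u \<mu> \<nu> w \<noteq> 0)" if "u \<noteq> 0" "\<mu> \<noteq> 0 \<or> \<nu> \<noteq> 0" for u \<mu> \<nu>
    using generic_theta_qpow[OF p that(1) \<tau>0 that(2)] by (simp add: T_def)
  have N: "entire2 N"
    unfolding N_def [abs_def] by (intro entire2_mult T nz)
  have D: "entire2 D"
    unfolding D_def [abs_def] by (intro entire2_mult W T nz) simp
  have gD: "generic (\<lambda>w. D w \<noteq> 0)"
    by (rule generic_mono[OF generic_conj[OF gen[of 1 "- 2 * \<gamma>" "- 2 * \<delta>"] gen[of d \<alpha> \<beta>]]])
       (use lin nz in \<open>auto simp: D_def W_def\<close>)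
  have gN: "generic (\<lambda>w. N w \<noteq> 0)"
    by (rule generic_mono[OF generic_conj[OF gen[of a "- \<gamma>" "- \<delta>"] generic_conj[OF gen[of b "- \<gamma>" "- \<delta>"]
          generic_conj[OF gen[of c "- \<gamma>" "- \<delta>"] gen[of "d / a" "\<alpha> - \<gamma>" "\<beta> - \<delta>"]]]]])
       (use lin nz in \<open>auto simp: N_def\<close>)
  show "entire_quotient F"
    unfolding F [abs_def] by (rule entire_quotientI[OF N D gD])
  show "generic (\<lambda>w. F w \<noteq> 0)"
    by (rule generic_mono[OF generic_conj[OF gN gD]]) (simp add: F)
qed

section \<open>Equality as meromorphic functions\<close>

lemma generic_regular_point:
  assumes \<tau>: "Re \<tau> = 0" "Im \<tau> > 0" "s > 0"
  shows "generic (\<lambda>w. regular_point (qpow \<tau> (of_real (s / 4))) (qpow \<tau> (of_real \<kappa>)) (qpow \<tau> (of_real lam))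
           (qpow \<tau> (fst w)) (qpow \<tau> (snd w / 2)))"
proof -
  define r K L where "r = qpow \<tau> (of_real (s / 4))" and "K = qpow \<tau> (of_real \<kappa>)" and "L = qpow \<tau> (of_real lam)"
  define X \<zeta> where "X w = qpow \<tau> (fst w)" and "\<zeta> w = qpow \<tau> (snd w / 2)" for w :: "complex \<times> complex"
  have "norm r < 1"
    using qpow_norm_less_1[of \<tau> "s / 4"] \<tau> by (simp add: r_def)
  then have p: "norm (r\<^sup>2) < 1" "r\<^sup>2 \<noteq> 0" "norm (r ^ 4) < 1" "r ^ 4 \<noteq> 0"
    by (simp_all add: norm_power power_less_one_iff r_def)
  have nz: "r \<noteq> 0" "K \<noteq> 0" "L \<noteq> 0" and \<tau>0: "\<tau> \<noteq> 0"
    using \<tau> by (auto simp: r_def K_def L_def)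
  have lin: "qpow \<tau> (\<alpha> * fst w + \<beta> * snd w) = qpow \<tau> (\<alpha> * fst w) * qpow \<tau> (\<beta> * snd w)" for \<alpha> \<beta> w
    by (rule qpow_add)
  have sq: "qpow \<tau> (2 * fst w) = (X w)\<^sup>2" "qpow \<tau> (snd w) = (\<zeta> w)\<^sup>2" for w
    by (simp_all add: X_def \<zeta>_def qpow_power)
  note gen2 = generic_theta_qpow[OF p(1,2) _ \<tau>0, unfolded lin]
  note gen4 = generic_theta_qpow[OF p(3,4) _ \<tau>0, unfolded lin]
  note fold = X_def [symmetric] \<zeta>_def [symmetric]
  have "generic (\<lambda>w. theta ((\<zeta> w)\<^sup>2) (r\<^sup>2) \<noteq> 0)"
    using gen2[of 1 0 1] by (simp add: sq)
  moreover have "generic (\<lambda>w. theta (- (\<zeta> w)\<^sup>2) (r\<^sup>2) \<noteq> 0)"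
    using gen2[of "- 1" 0 1] by (simp add: sq)
  moreover have "generic (\<lambda>w. theta ((X w)\<^sup>2) (r\<^sup>2) \<noteq> 0)"
    using gen2[of 1 2 0] by (simp add: sq)
  moreover have "generic (\<lambda>w. theta (r * X w) (r\<^sup>2) \<noteq> 0)"
    using gen2[of r 1 0] nz by (simp add: X_def)
  moreover have "generic (\<lambda>w. theta (- r * X w) (r\<^sup>2) \<noteq> 0)"
    using gen2[of "- r" 1 0] nz by (simp add: X_def)
  moreover have "generic (\<lambda>w. theta (- r * L * \<zeta> w) (r\<^sup>2) \<noteq> 0)"
    using gen2[of "- r * L" 0 "1 / 2"] nz by (simp add: \<zeta>_def)
  moreover have "generic (\<lambda>w. theta (K * L * X w) (r\<^sup>2) \<noteq> 0)"
    using gen2[of "K * L" 1 0] nz by (simp add: X_def)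
  moreover have "generic (\<lambda>w. theta (- K * X w / L) (r\<^sup>2) \<noteq> 0)"
    using gen2[of "- K / L" 1 0] nz by (simp add: X_def)
  moreover have "generic (\<lambda>w. theta (- r * X w * \<zeta> w / K) (r\<^sup>2) \<noteq> 0)"
    using gen2[of "- r / K" 1 "1 / 2"] nz by (simp add: X_def \<zeta>_def mult_ac)
  moreover have "generic (\<lambda>w. theta (- r\<^sup>2 * X w * (\<zeta> w)\<^sup>2 / (K * L)) (r ^ 4) \<noteq> 0)"
    using gen4[of "- r\<^sup>2 / (K * L)" 1 1] nz by (simp add: sq fold(1) mult_ac)
  ultimately have "generic (\<lambda>w. regular_point r K L (X w) (\<zeta> w))"
    unfolding regular_point_def by (intro generic_conj)
  then show ?thesis
    by (simp only: r_def K_def L_def X_def \<zeta>_def)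
qed

lemma c_functions_entire_quotients:
  assumes \<tau>: "Re \<tau> = 0" "Im \<tau> > 0" "s > 0" and \<epsilon>: "\<epsilon> \<noteq> 0"
  shows "entire_quotient (\<lambda>w. cJ \<tau> s \<kappa> lam (fst w) (\<epsilon> * snd w))"
    and "entire_quotient (\<lambda>w. cR \<tau> s \<kappa> lam (fst w) (\<epsilon> * snd w))"
    and "entire_quotient (\<lambda>w. cJd \<tau> s \<kappa> lam (snd w) (\<epsilon> * fst w))"
    and "generic (\<lambda>w. cJd \<tau> s \<kappa> lam (snd w) (\<epsilon> * fst w) \<noteq> 0)"
    and "entire_quotient (\<lambda>w. cRd \<tau> s \<kappa> lam (snd w / 2) (\<epsilon> * fst w))"
    and "generic (\<lambda>w. cRd \<tau> s \<kappa> lam (snd w / 2) (\<epsilon> * fst w) \<noteq> 0)"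
  using cfun_entire_quotient_generic_nonzero[OF \<tau>, of 1 0 0 \<epsilon>]
    cfun_entire_quotient_generic_nonzero[OF \<tau>(1,2), of "s / 2" 1 0 0 "\<epsilon> / 2"]
    cfun_entire_quotient_generic_nonzero[OF \<tau>, of 0 1 \<epsilon> 0]
    cfun_entire_quotient_generic_nonzero[OF \<tau>(1,2), of "s / 2" 0 "1 / 2" "\<epsilon> / 2" 0] \<tau>(3) \<epsilon>
  by (simp_all add: cJ_def cJd_def cR_def cRd_def)

theorem proposition7p3:
  fixes \<tau> :: complex and s \<kappa> lam :: real
  assumes "Re \<tau> = 0" and "Im \<tau> > 0"
    and "s \<in> \<rat>" and "s > 0"
  shows "meromorphic2_eq
           (\<lambda>(x, z). cJ \<tau> s \<kappa> lam x (- z) / cJd \<tau> s \<kappa> lam z (- x))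
           (\<lambda>(x, z). cR \<tau> s \<kappa> lam x (- z) / cRd \<tau> s \<kappa> lam (z / 2) (- 2 * x))
         \<and> meromorphic2_eq
           (\<lambda>(x, z). (cJ \<tau> s \<kappa> lam x z - cJd \<tau> s \<kappa> lam z x) / cJd \<tau> s \<kappa> lam z (- x))
           (\<lambda>(x, z). (cR \<tau> s \<kappa> lam x z - cRd \<tau> s \<kappa> lam (z / 2) (2 * x))
                       / cRd \<tau> s \<kappa> lam (z / 2) (- 2 * x))"
proof -
  define r K L where "r = qpow \<tau> (of_real (s / 4))" and "K = qpow \<tau> (of_real \<kappa>)" and "L = qpow \<tau> (of_real lam)"
  have r: "norm r < 1" "r \<noteq> 0" and KL: "K \<noteq> 0" "L \<noteq> 0"
    using qpow_norm_less_1[of \<tau> "s / 4"] assms by (simp_all add: r_def K_def L_def)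
  note c = c_functions_as_theta_quotients[of \<tau> s \<kappa> lam, folded r_def K_def L_def]
  have reflect: "qpow \<tau> (- x) = 1 / qpow \<tau> x" "qpow \<tau> (- z / 2) = 1 / qpow \<tau> (z / 2)" for x z
    by (simp_all add: qpow_minus)
  have pointwise:
    "cJ \<tau> s \<kappa> lam x (- z) / cJd \<tau> s \<kappa> lam z (- x) = cR \<tau> s \<kappa> lam x (- z) / cRd \<tau> s \<kappa> lam (z / 2) (- 2 * x)"
    "(cJ \<tau> s \<kappa> lam x z - cJd \<tau> s \<kappa> lam z x) / cJd \<tau> s \<kappa> lam z (- x)
       = (cR \<tau> s \<kappa> lam x z - cRd \<tau> s \<kappa> lam (z / 2) (2 * x)) / cRd \<tau> s \<kappa> lam (z / 2) (- 2 * x)"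
    if reg: "regular_point r K L (qpow \<tau> x) (qpow \<tau> (z / 2))" for x z
  proof -
    interpret theta_quotients r K L "qpow \<tau> x" "qpow \<tau> (z / 2)"
      using r KL reg by unfold_locales simp_all
    have minus: "- 2 * x = 2 * (- x)"
      by simp
    \<comment> \<open>All four functions carry the same weight at corresponding arguments, so both sides of either equation
      have the same factor \<open>v / u\<close>.\<close>
    have cancel: "a / u / (b / v) = a / b * (v / u)" "a / u - a' / u = (a - a') / u" for a a' b u v :: complex
      by (simp_all add: diff_divide_distrib)
    show "cJ \<tau> s \<kappa> lam x (- z) / cJd \<tau> s \<kappa> lam z (- x) = cR \<tau> s \<kappa> lam x (- z) / cRd \<tau> s \<kappa> lam (z / 2) (- 2 * x)"
      unfolding minus c reflect cancel ratio_identity ..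
    show "(cJ \<tau> s \<kappa> lam x z - cJd \<tau> s \<kappa> lam z x) / cJd \<tau> s \<kappa> lam z (- x)
       = (cR \<tau> s \<kappa> lam x z - cRd \<tau> s \<kappa> lam (z / 2) (2 * x)) / cRd \<tau> s \<kappa> lam (z / 2) (- 2 * x)"
      unfolding minus c reflect cancel difference_identity ..
  qed
  note generic_reg = generic_regular_point[OF assms(1,2,4), of \<kappa> lam, folded r_def K_def L_def]
  note quot = c_functions_entire_quotients[OF assms(1,2,4), of _ \<kappa> lam]
  have eq1: "meromorphic2_eq
      (\<lambda>w. cJ \<tau> s \<kappa> lam (fst w) (- 1 * snd w) / cJd \<tau> s \<kappa> lam (snd w) (- 1 * fst w))
      (\<lambda>w. cR \<tau> s \<kappa> lam (fst w) (- 1 * snd w) / cRd \<tau> s \<kappa> lam (snd w / 2) (- 2 * fst w))"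
    by (intro meromorphic2_eqI entire_quotient_divide quot generic_mono[OF generic_reg])
       (use pointwise(1) in auto)
  have eq2: "meromorphic2_eq
      (\<lambda>w. (cJ \<tau> s \<kappa> lam (fst w) (1 * snd w) - cJd \<tau> s \<kappa> lam (snd w) (1 * fst w))
           / cJd \<tau> s \<kappa> lam (snd w) (- 1 * fst w))
      (\<lambda>w. (cR \<tau> s \<kappa> lam (fst w) (1 * snd w) - cRd \<tau> s \<kappa> lam (snd w / 2) (2 * fst w))
           / cRd \<tau> s \<kappa> lam (snd w / 2) (- 2 * fst w))"
    by (intro meromorphic2_eqI entire_quotient_divide entire_quotient_diff quot generic_mono[OF generic_reg])
       (use pointwise(2) in auto)
  show ?thesis
    using eq1 eq2 by (simp add: case_prod_unfold)
qed

end
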